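(* There is an absolute constant $c>0$ such that, for all integers $1\le m\le n$ and every function $f:\{-1,1\}^n\to[-1,1]$ of degree at most $m$ for which there exist $a_0,\ldots,a_m\ge0$ with $|\widehat f(S)|=a_{|S|}$ for all $S\subseteq[n]$ with $|S|\le m$, one has $$\operatorname{Inf}_i(f)\ge\frac{c}{m^{54}}\operatorname{Var}(f)^2\qquad\text{for every }i\in[n].$$
   Context: Let $[n]=\{1,\dots,n\}$ and equip $\{-1,1\}^n$ with its uniform probability measure, with expectation $\mathbb{E}$. Every $f:\{-1,1\}^n\to\mathbb{C}$ has the Fourier--Walsh expansion $f(x)=\sum_{S\subseteq[n]}\widehat f(S)x^S$, where $x^S=\prod_{j\in S}x_j$ and $\widehat f(S)=\mathbb{E}[f(x)x^S]$. The function $f$ has degree at most $m$ if $\widehat f(S)=0$ whenever $|S|>m$. For real-valued $f$ on $\{-1,1\}^n$ and $i\in[n]$, $$\operatorname{Var}(f)=\mathbb{E}|f-\mathbb{E}f|^2=\sum_{S\ne\varnothing}|\widehat f(S)|^2,\qquad \operatorname{Inf}_i(f)=\sum_{S\ni i}|\widehat f(S)|^2.$$ *)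

theory Defs
  imports "HOL-Probability.Probability"
begin

text \<open>
  A point of the hypercube is an extensional function on \<open>{1..n}\<close> (it is \<open>undefined\<close> outside),
  so that \<open>hypercube n\<close> has exactly \<open>2 ^ n\<close> elements. Functions on the hypercube are total
  functions on \<open>nat \<Rightarrow> real\<close>; every notion below depends only on their values on \<open>hypercube n\<close>.
\<close>

definition hypercube :: "nat \<Rightarrow> (nat \<Rightarrow> real) set" where
  "hypercube n = ({1..n} \<rightarrow>\<^sub>E {-1, 1})"

definition unif_cube :: "nat \<Rightarrow> (nat \<Rightarrow> real) pmf" where
  "unif_cube n = pmf_of_set (hypercube n)"

definition walsh :: "nat set \<Rightarrow> (nat \<Rightarrow> real) \<Rightarrow> real" where
  "walsh S x = (\<Prod>j\<in>S. x j)"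

definition fourier_coeff :: "nat \<Rightarrow> ((nat \<Rightarrow> real) \<Rightarrow> real) \<Rightarrow> nat set \<Rightarrow> real" where
  "fourier_coeff n f S = measure_pmf.expectation (unif_cube n) (\<lambda>x. f x * walsh S x)"

definition degree_at_most :: "nat \<Rightarrow> nat \<Rightarrow> ((nat \<Rightarrow> real) \<Rightarrow> real) \<Rightarrow> bool" where
  "degree_at_most n m f \<longleftrightarrow> (\<forall>S\<subseteq>{1..n}. card S > m \<longrightarrow> fourier_coeff n f S = 0)"

definition cube_var :: "nat \<Rightarrow> ((nat \<Rightarrow> real) \<Rightarrow> real) \<Rightarrow> real" where
  "cube_var n f = measure_pmf.variance (unif_cube n) f"

definition influence :: "nat \<Rightarrow> nat \<Rightarrow> ((nat \<Rightarrow> real) \<Rightarrow> real) \<Rightarrow> real" where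
  "influence n i f = (\<Sum>S | S \<subseteq> {1..n} \<and> i \<in> S. \<bar>fourier_coeff n f S\<bar>\<^sup>2)"

end

theory Submission
  imports Defs "HOL-Complex_Analysis.Complex_Analysis"
begin

text \<open>
  Flatness turns the claim into the bound \<open>n W\<^sub>d \<le> m\<^sup>O\<^sup>(\<^sup>1\<^sup>)\<close> for the Fourier weight \<open>W\<^sub>d\<close> of every level
  \<open>1 \<le> d \<le> m\<close>. This follows from a Bohnenblust--Hille inequality on the cube with exponent
  \<open>2d/(d+1)\<close> and a constant polynomial in \<open>m\<close>, because \<open>binom(n,d)\<^sup>1\<^sup>/\<^sup>d \<ge> n/d\<close>.

  The inequality is obtained by halving the level. Split the coordinates at random into two blocks;
  a set of size \<open>d\<close> typically meets both in roughly \<open>d/2\<close> elements. For every assignment of one block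
  the restriction to the other is again bounded by 1 and of degree at most \<open>m\<close>, so nothing is lost in
  sup norm and the inequality for levels near \<open>d/2\<close> applies to it. Averaging over the assignment costs
  only a constant: at level \<open>k\<close> the exponent \<open>2k/(k+1)\<close> is so close to 2 that hypercontractivity loses
  \<open>3\<^sup>D\<^sup>/\<^sup>k\<close> on degree \<open>D \<le> 2k\<close>. Interpolating between the estimates for the two blocks gives precisely the
  exponent of level \<open>d\<close>. All levels of a window \<open>{a..b}\<close> with \<open>b \<le> 3a/2\<close> are treated simultaneously, so
  each of the \<open>O(log m)\<close> halving steps costs a constant factor. Levels 2 and 3 are reduced to
  level 1 by extracting low-degree coefficients with Bernstein's inequality.
\<close>

subsection \<open>Low coefficients of bounded polynomials\<close>

text \<open>The polynomial \<open>q(w) = w\<^sup>m p((w + 1/w)/2)\<close> is bounded by 1 on the unit circle and self-reciprocal, hence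
  bounded by \<open>max(1, |w|)\<^sup>2\<^sup>m\<close> everywhere; Cauchy's estimate at \<open>w = \<i>\<close>, where \<open>(w + 1/w)/2 = 0\<close>, gives the claim.\<close>

lemma abs_pderiv_0_le:
  fixes p :: "real poly"
  assumes deg: "degree p \<le> m" and m: "1 \<le> m" and bd: "\<And>t. \<bar>t\<bar> \<le> 1 \<Longrightarrow> \<bar>poly p t\<bar> \<le> 1"
  shows "\<bar>poly (pderiv p) 0\<bar> \<le> 10 * real m"
proof -
  define P :: "complex poly" where "P = map_poly of_real p"
  have coeffP: "coeff P k = of_real (coeff p k)" for k
    by (simp add: P_def coeff_map_poly)
  have degP: "degree P \<le> m"
    using deg by (simp add: P_def degree_map_poly)
  have P_real: "poly P (of_real t) = of_real (poly p t)" for t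
    unfolding P_def by (induct p) (auto simp: map_poly_pCons)
  \<comment> \<open>Clearing denominators gives a polynomial in \<open>w\<close>, which is
    holomorphic also at 0, where \<open>(w + 1 / w) / 2\<close> has a pole.\<close>
  define q where "q w = (\<Sum>k\<le>m. coeff P k * (w ^ (m - k) * ((w\<^sup>2 + 1) / 2) ^ k))" for w :: complex
  have q_eq: "q w = w ^ m * poly P ((w + 1 / w) / 2)" if "w \<noteq> 0" for w
  proof -
    have "poly P z = (\<Sum>k\<le>m. coeff P k * z ^ k)" for z
    proof -
      have "poly P z = (\<Sum>k\<le>degree P. coeff P k * z ^ k)"
        by (rule poly_altdef)
      also have "\<dots> = (\<Sum>k\<le>m. coeff P k * z ^ k)"
        using degP by (intro sum.mono_neutral_left) (auto simp: coeff_eq_0)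
      finally show ?thesis .
    qed
    moreover have "w ^ (m - k) * ((w\<^sup>2 + 1) / 2) ^ k = w ^ m * ((w + 1 / w) / 2) ^ k" if "k \<le> m" for k
    proof -
      have "(w\<^sup>2 + 1) / 2 = w * ((w + 1 / w) / 2)"
        using \<open>w \<noteq> 0\<close> by (simp add: field_simps power2_eq_square)
      then show ?thesis
        using that by (simp add: power_mult_distrib power_add [symmetric] mult.assoc [symmetric] del: times_divide_eq_right)
    qed
    ultimately show ?thesis
      unfolding q_def by (simp add: sum_distrib_left algebra_simps)
  qed
  have hol: "q holomorphic_on A" for A
    unfolding q_def by (intro holomorphic_intros) auto
  have circle: "norm (q w) \<le> 1" if "norm w = 1" for w
  proof -
    have "w \<noteq> 0" using that by auto
    have "1 / w = cnj w"
      using that by (simp add: divide_conv_cnj)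
    then have "(w + 1 / w) / 2 = of_real (Re w)"
      by (simp add: complex_add_cnj)
    then have "norm (q w) = \<bar>poly p (Re w)\<bar>"
      using q_eq [OF \<open>w \<noteq> 0\<close>] that by (simp add: norm_mult norm_power P_real)
    also have "\<dots> \<le> 1"
      using abs_Re_le_cmod [of w] that by (intro bd) auto
    finally show ?thesis .
  qed
  have disc: "norm (q w) \<le> 1" if "norm w \<le> 1" for w
  proof (rule maximum_modulus_frontier [of q "cball 0 1"])
    show "continuous_on (closure (cball 0 1)) q"
      using hol holomorphic_on_imp_continuous_on by blast
  qed (use that circle hol in auto)
  have outside: "norm (q w) \<le> norm w ^ (2 * m)" if "norm w \<ge> 1" for w
  proof -
    have "w \<noteq> 0" using that by auto
    have "q w = w ^ (2 * m) * q (1 / w)"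
      using \<open>w \<noteq> 0\<close> by (simp add: q_eq power_mult power2_eq_square field_simps power_mult_distrib)
    moreover have "norm (q (1 / w)) \<le> 1"
      using that by (intro disc) (simp add: norm_divide divide_le_eq_1)
    ultimately show ?thesis
      by (simp add: norm_mult norm_power mult_left_le)
  qed
  \<comment> \<open>The radius \<open>1 / m\<close> is small enough that
    \<open>norm w ^ (2 * m)\<close> stays below
    \<open>(1 + 1 / m) ^ (2 * m) \<le> exp 2 \<le> 9\<close>.\<close>
  have near: "norm (q w) \<le> 9" if "norm (\<i> - w) = 1 / real m" for w
  proof (cases "norm w \<le> 1")
    case True
    then show ?thesis using disc [of w] by simp
  next
    case False
    have "norm w \<le> norm \<i> + norm (w - \<i>)"
      using norm_triangle_ineq [of \<i> "w - \<i>"] by simp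
    then have "norm w \<le> 1 + 1 / real m"
      using that by (simp add: norm_minus_commute)
    also have "\<dots> \<le> exp (1 / real m)"
      by (rule exp_ge_add_one_self)
    finally have "norm w ^ (2 * m) \<le> exp (1 / real m) ^ (2 * m)"
      by (rule power_mono) auto
    also have "\<dots> = exp 1 ^ 2"
      using m by (simp add: exp_of_nat_mult [symmetric] flip: exp_double)
    also have "\<dots> \<le> 3 ^ 2"
      by (intro power_mono exp_le) auto
    finally show ?thesis
      using outside [of w] False by simp
  qed
  have "norm ((deriv ^^ 1) q \<i>) \<le> fact 1 * 9 / (1 / real m) ^ 1"
    using m hol by (intro Cauchy_inequality near holomorphic_on_imp_continuous_on) auto
  then have dq: "norm (deriv q \<i>) \<le> 9 * real m"
    by simp
  \<comment> \<open>At \<open>\<i>\<close> the inner map has derivative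
    \<open>(1 - 1 / w^2) / 2 = 1\<close>, so the chain rule yields the derivative of
    \<open>P\<close> at 0 with no extra factor.\<close>
  have "((\<lambda>w. w ^ m * poly P ((w + 1 / w) / 2)) has_field_derivative
      (of_nat m * \<i> ^ (m - 1) * poly P 0 + \<i> ^ m * poly (pderiv P) 0)) (at \<i>)"
    by (auto intro!: derivative_eq_intros simp: field_simps)
  then have "(q has_field_derivative
      (of_nat m * \<i> ^ (m - 1) * poly P 0 + \<i> ^ m * poly (pderiv P) 0)) (at \<i>)"
    by (rule has_field_derivative_transform_within_open [where S = "-{0}"]) (auto simp: q_eq)
  then have "\<i> ^ m * poly (pderiv P) 0 = deriv q \<i> - of_nat m * \<i> ^ (m - 1) * poly P 0"
    by (simp add: DERIV_imp_deriv)
  then have "norm (\<i> ^ m * poly (pderiv P) 0) \<le> norm (deriv q \<i>) + norm (of_nat m * \<i> ^ (m - 1) * poly P 0)"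
    using norm_triangle_ineq4 by metis
  also have "norm (of_nat m * \<i> ^ (m - 1) * poly P 0) \<le> m"
    using bd [of 0] P_real [of 0] by (simp add: norm_mult norm_power mult_left_le)
  finally have "norm (poly (pderiv P) 0) \<le> 10 * real m"
    using dq by (simp add: norm_mult norm_power)
  moreover have "poly (pderiv P) 0 = of_real (poly (pderiv p) 0)"
    by (simp add: poly_0_coeff_0 coeff_pderiv coeffP)
  ultimately show ?thesis by simp
qed

lemma abs_coeff_1_le:
  fixes p :: "real poly"
  assumes "degree p \<le> m" "1 \<le> m" "\<And>t. \<bar>t\<bar> \<le> 1 \<Longrightarrow> \<bar>poly p t\<bar> \<le> 1"
  shows "\<bar>coeff p 1\<bar> \<le> 10 * real m"
  using abs_pderiv_0_le [OF assms] by (simp add: poly_0_coeff_0 coeff_pderiv)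

text \<open>Two applications of the derivative bound. Applied to
  \<open>s \<mapsto> p (t + s / 2)\<close> it controls \<open>p'\<close> on [-1/2, 1/2]; applied to
  \<open>p'\<close>, rescaled to [-1, 1] and divided by its bound \<open>20 * m\<close>, it controls
  \<open>p'' 0\<close>, which is twice the coefficient.\<close>

lemma abs_coeff_2_le:
  fixes p :: "real poly"
  assumes deg: "degree p \<le> m" and m: "1 \<le> m" and bd: "\<And>t. \<bar>t\<bar> \<le> 1 \<Longrightarrow> \<bar>poly p t\<bar> \<le> 1"
  shows "\<bar>coeff p 2\<bar> \<le> 200 * real m ^ 2"
proof -
  have d1: "\<bar>poly (pderiv p) t\<bar> \<le> 20 * real m" if t: "\<bar>t\<bar> \<le> 1 / 2" for t
  proof -
    let ?r = "pcompose p [:t, 1/2:]"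
    have "\<bar>poly (pderiv ?r) 0\<bar> \<le> 10 * real m"
    proof (rule abs_pderiv_0_le)
      show "degree ?r \<le> m" using deg by (simp add: degree_pcompose)
      show "\<bar>poly ?r s\<bar> \<le> 1" if "\<bar>s\<bar> \<le> 1" for s
        using that t by (simp add: poly_pcompose bd)
    qed fact
    then show ?thesis
      by (simp add: pderiv_pcompose poly_pcompose pderiv_pCons)
  qed
  let ?r = "smult (1 / (20 * real m)) (pcompose (pderiv p) [:0, 1/2:])"
  have "\<bar>poly (pderiv ?r) 0\<bar> \<le> 10 * real m"
  proof (rule abs_pderiv_0_le)
    show "degree ?r \<le> m"
      using deg by (auto simp: degree_pcompose degree_pderiv)
    show "\<bar>poly ?r s\<bar> \<le> 1" if "\<bar>s\<bar> \<le> 1" for s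
      using d1 [of "s / 2"] that m by (simp add: poly_pcompose abs_mult field_simps)
  qed fact
  then have "\<bar>poly (pderiv (pderiv p)) 0\<bar> \<le> 400 * real m ^ 2"
    using m by (simp add: pderiv_pcompose poly_pcompose pderiv_pCons pderiv_smult abs_mult field_simps power2_eq_square)
  moreover have "poly (pderiv (pderiv p)) 0 = 2 * coeff p 2"
    by (simp add: poly_0_coeff_0 coeff_pderiv numeral_2_eq_2)
  ultimately show ?thesis by simp
qed

subsection \<open>Fourier analysis on sign vectors\<close>

text \<open>Vertices of the cube are indexed by the set of their negative coordinates, so that
  averages become sums over \<open>Pow V\<close> and can be split by induction on
  \<open>V\<close>.\<close>

definition sign_vec :: "nat set \<Rightarrow> nat \<Rightarrow> real" where
  "sign_vec Y j = (if j \<in> Y then -1 else 1)"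

text \<open>The multilinear extension: \<open>x\<close> may be any real point, not only a
  vertex.\<close>

definition walsh_poly :: "(nat set \<Rightarrow> real) \<Rightarrow> nat set \<Rightarrow> (nat \<Rightarrow> real) \<Rightarrow> real" where
  "walsh_poly c V x = (\<Sum>S\<in>Pow V. c S * walsh S x)"

definition cube_avg :: "nat set \<Rightarrow> ((nat \<Rightarrow> real) \<Rightarrow> real) \<Rightarrow> real" where
  "cube_avg V g = (\<Sum>Y\<in>Pow V. g (sign_vec Y)) / 2 ^ card V"

lemma walsh_cong: "(\<And>j. j \<in> S \<Longrightarrow> x j = y j) \<Longrightarrow> walsh S x = walsh S y"
  unfolding walsh_def by (rule prod.cong) auto

lemma walsh_empty [simp]: "walsh {} x = 1"
  by (simp add: walsh_def)

lemma walsh_insert: "finite S \<Longrightarrow> j \<notin> S \<Longrightarrow> walsh (insert j S) x = x j * walsh S x"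
  by (simp add: walsh_def)

lemma walsh_Un: "finite S \<Longrightarrow> finite T \<Longrightarrow> S \<inter> T = {} \<Longrightarrow> walsh (S \<union> T) x = walsh S x * walsh T x"
  by (simp add: walsh_def prod.union_disjoint)

lemma sum_Pow_insert:
  fixes F :: "'a set \<Rightarrow> real"
  assumes "finite V" "j \<notin> V"
  shows "(\<Sum>S\<in>Pow (insert j V). F S) = (\<Sum>S\<in>Pow V. F S) + (\<Sum>S\<in>Pow V. F (insert j S))"
proof -
  have "inj_on (insert j) (Pow V)"
    using \<open>j \<notin> V\<close> by (intro inj_onI) (metis PowD insert_ident subset_iff)
  then have "(\<Sum>S\<in>Pow V. F (insert j S)) = sum F (insert j ` Pow V)"
    by (simp add: sum.reindex)
  moreover have "Pow V \<inter> insert j ` Pow V = {}"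
    using \<open>j \<notin> V\<close> by auto
  ultimately show ?thesis
    using \<open>finite V\<close> by (simp add: Pow_insert sum.union_disjoint)
qed

lemma sum_Pow_Un:
  fixes F :: "'a set \<Rightarrow> real"
  assumes "A \<inter> B = {}"
  shows "(\<Sum>S\<in>Pow (A \<union> B). F S) = (\<Sum>I\<in>Pow A. \<Sum>J\<in>Pow B. F (I \<union> J))"
  unfolding sum.cartesian_product
  by (rule sum.reindex_bij_witness [where i = "\<lambda>(I, J). I \<union> J" and j = "\<lambda>S. (S \<inter> A, S \<inter> B)"])
    (use assms in \<open>auto simp flip: Int_Un_distrib simp: Int_absorb2\<close>)

lemma cube_avg_cong: "(\<And>Y. Y \<subseteq> V \<Longrightarrow> g (sign_vec Y) = h (sign_vec Y)) \<Longrightarrow> cube_avg V g = cube_avg V h"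
  by (simp add: cube_avg_def)

lemma cube_avg_mono: "(\<And>Y. Y \<subseteq> V \<Longrightarrow> g (sign_vec Y) \<le> h (sign_vec Y)) \<Longrightarrow> cube_avg V g \<le> cube_avg V h"
  by (auto simp: cube_avg_def intro!: divide_right_mono sum_mono)

lemma cube_avg_nonneg: "(\<And>Y. Y \<subseteq> V \<Longrightarrow> 0 \<le> g (sign_vec Y)) \<Longrightarrow> 0 \<le> cube_avg V g"
  by (auto simp: cube_avg_def intro!: divide_nonneg_nonneg sum_nonneg)

lemma cube_avg_add: "cube_avg V (\<lambda>y. g y + h y) = cube_avg V g + cube_avg V h"
  by (simp add: cube_avg_def sum.distrib add_divide_distrib)

lemma cube_avg_cmult: "cube_avg V (\<lambda>y. a * g y) = a * cube_avg V g"
  by (simp add: cube_avg_def sum_distrib_left)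

lemma cube_avg_sum: "cube_avg V (\<lambda>y. \<Sum>i\<in>I. g i y) = (\<Sum>i\<in>I. cube_avg V (g i))"
  unfolding cube_avg_def by (subst sum.swap) (simp add: sum_divide_distrib)

lemma cube_avg_const: "finite V \<Longrightarrow> cube_avg V (\<lambda>y. a) = a"
  by (simp add: cube_avg_def card_Pow)

text \<open>Only one half needs an update: since \<open>j\<close> lies outside \<open>V\<close>,
  every \<open>sign_vec Y\<close> with \<open>Y \<subseteq> V\<close> already has value 1 at
  \<open>j\<close>.\<close>

lemma cube_avg_insert:
  assumes "finite V" "j \<notin> V"
  shows "cube_avg (insert j V) g = (cube_avg V g + cube_avg V (\<lambda>y. g (y(j := -1)))) / 2"
proof -
  have "sign_vec (insert j Y) = (sign_vec Y)(j := -1)" for Y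
    by (auto simp: sign_vec_def)
  then show ?thesis
    using assms by (simp add: cube_avg_def sum_Pow_insert add_divide_distrib)
qed

lemma sign_vec_sq [simp]: "sign_vec Y j * sign_vec Y j = 1"
  by (simp add: sign_vec_def)

lemma abs_sign_vec [simp]: "\<bar>sign_vec Y j\<bar> = 1"
  by (simp add: sign_vec_def)

text \<open>Flipping a single coordinate of \<open>U\<close> changes the sign of the character, so
  the two halves cancel.\<close>

lemma cube_avg_walsh:
  assumes "finite V" "U \<subseteq> V" "U \<noteq> {}"
  shows "cube_avg V (walsh U) = 0"
proof -
  obtain j where j: "j \<in> U" using assms by auto
  define W where "W = V - {j}"
  have V: "V = insert j W" "finite W" "j \<notin> W"
    using assms j by (auto simp: W_def)
  have U: "U = insert j (U - {j})" "finite (U - {j})"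
    using j assms finite_subset by auto
  have "walsh U ((sign_vec Y)(j := -1)) = - walsh U (sign_vec Y)" if "Y \<subseteq> W" for Y
  proof -
    have "walsh (U - {j}) ((sign_vec Y)(j := -1)) = walsh (U - {j}) (sign_vec Y)"
      by (rule walsh_cong) auto
    moreover have "sign_vec Y j = 1"
      using that V by (auto simp: sign_vec_def)
    ultimately show ?thesis
      using walsh_insert [of "U - {j}" j] U(2) j by (simp add: insert_absorb)
  qed
  then have "cube_avg W (\<lambda>y. walsh U (y(j := -1))) = cube_avg W (\<lambda>y. - 1 * walsh U y)"
    by (intro cube_avg_cong) simp
  then show ?thesis
    unfolding V(1) cube_avg_insert [OF V(2,3)] by (subst (asm) cube_avg_cmult) simp
qed

lemma walsh_mult:
  assumes "finite S" "finite T"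
  shows "walsh S (sign_vec Y) * walsh T (sign_vec Y) = walsh (sym_diff S T) (sign_vec Y)"
proof -
  have S: "walsh S x = walsh (S - T) x * walsh (S \<inter> T) x" and T: "walsh T x = walsh (T - S) x * walsh (S \<inter> T) x" for x
    using assms by (subst walsh_Un [symmetric]; auto intro!: arg_cong [where f = "\<lambda>S. walsh S x"])+
  have "walsh (S \<inter> T) (sign_vec Y) * walsh (S \<inter> T) (sign_vec Y) = 1"
    by (simp add: walsh_def flip: prod.distrib)
  moreover have "walsh (sym_diff S T) (sign_vec Y) = walsh (S - T) (sign_vec Y) * walsh (T - S) (sign_vec Y)"
    using assms by (subst walsh_Un [symmetric]) auto
  ultimately show ?thesis
    unfolding S [of "sign_vec Y"] T [of "sign_vec Y"] by (simp add: mult.assoc mult.left_commute)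
qed

lemma cube_avg_orthonormal:
  assumes "finite V" "S \<subseteq> V" "T \<subseteq> V"
  shows "cube_avg V (\<lambda>y. walsh S y * walsh T y) = (if S = T then 1 else 0)"
proof -
  have fin: "finite S" "finite T" using assms finite_subset by auto
  have "cube_avg V (\<lambda>y. walsh S y * walsh T y) = cube_avg V (walsh (sym_diff S T))"
    by (intro cube_avg_cong walsh_mult fin)
  also have "\<dots> = (if S = T then 1 else 0)"
  proof (cases "S = T")
    case True
    then show ?thesis using assms using cube_avg_const [of V 1] by (simp add: walsh_def [abs_def])
  next
    case False
    then show ?thesis using assms by (subst cube_avg_walsh) auto
  qed
  finally show ?thesis .
qed

text \<open>One factor is only a partial sum, because the duality argument later pairs a polynomial
  with a selected part of itself.\<close>

lemma cube_avg_inner: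
  assumes "finite V" "\<T> \<subseteq> Pow V"
  shows "cube_avg V (\<lambda>y. (\<Sum>T\<in>\<T>. a T * walsh T y) * walsh_poly b V y) = (\<Sum>T\<in>\<T>. a T * b T)"
proof -
  have "cube_avg V (\<lambda>y. (\<Sum>T\<in>\<T>. a T * walsh T y) * walsh_poly b V y)
      = cube_avg V (\<lambda>y. \<Sum>T\<in>\<T>. \<Sum>S\<in>Pow V. (a T * b S) * (walsh T y * walsh S y))"
    unfolding walsh_poly_def sum_product by (simp add: mult_ac)
  also have "\<dots> = (\<Sum>T\<in>\<T>. \<Sum>S\<in>Pow V. (a T * b S) * (if T = S then 1 else 0))"
    unfolding cube_avg_sum cube_avg_cmult
    using assms by (intro sum.cong refl) (subst cube_avg_orthonormal, auto)
  also have "\<dots> = (\<Sum>T\<in>\<T>. a T * b T)"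
    using assms by (intro sum.cong refl) (auto simp: sum.delta' if_distrib cong: if_cong)
  finally show ?thesis .
qed

lemma cube_avg_parseval:
  assumes "finite V"
  shows "cube_avg V (\<lambda>y. (walsh_poly a V y)\<^sup>2) = (\<Sum>T\<in>Pow V. (a T)\<^sup>2)"
  using cube_avg_inner [OF assms order.refl, of a a]
  by (simp add: power2_eq_square walsh_poly_def)

lemma walsh_poly_insert:
  assumes "finite V" "j \<notin> V"
  shows "walsh_poly a (insert j V) y = walsh_poly a V y + y j * walsh_poly (\<lambda>T. a (insert j T)) V y"
proof -
  have "walsh (insert j S) y = y j * walsh S y" if "S \<in> Pow V" for S
    using that assms finite_subset by (intro walsh_insert) auto
  then show ?thesis
    using assms by (simp add: walsh_poly_def sum_Pow_insert sum_distrib_left mult_ac)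
qed

lemma walsh_poly_cong: "(\<And>j. j \<in> V \<Longrightarrow> x j = y j) \<Longrightarrow> walsh_poly c V x = walsh_poly c V y"
  unfolding walsh_poly_def by (intro sum.cong refl arg_cong2 [where f = "(*)"] walsh_cong) auto

section \<open>Fourth moments of low-degree polynomials\<close>

lemma cube_avg_Cauchy_Schwarz:
  "(cube_avg V (\<lambda>y. g y * h y))\<^sup>2 \<le> cube_avg V (\<lambda>y. (g y)\<^sup>2) * cube_avg V (\<lambda>y. (h y)\<^sup>2)"
  unfolding cube_avg_def power_divide times_divide_times_eq power2_eq_square [of "2 ^ _"]
  by (intro divide_right_mono Cauchy_Schwarz_ineq_sum) auto

text \<open>Bonami's hypercontractive inequality, by induction on the variables. For
  \<open>u + x_j w\<close> the odd powers of \<open>x_j\<close> average out. As \<open>w\<close> has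
  degree at most \<open>D - 1\<close>, Cauchy-Schwarz bounds the mixed term by 6 * 3 * 9^(D-1) U W,
  which is exactly the cross term 2 * 9^D U W of the target.\<close>

lemma bonami_2_4:
  assumes "finite V" "\<And>T. T \<subseteq> V \<Longrightarrow> D < card T \<Longrightarrow> a T = 0"
  shows "cube_avg V (\<lambda>y. walsh_poly a V y ^ 4) \<le> 9 ^ D * (\<Sum>T\<in>Pow V. (a T)\<^sup>2)\<^sup>2"
  using assms
proof (induction V arbitrary: a D rule: finite_induct)
  case empty
  have "((a {})\<^sup>2)\<^sup>2 \<le> 9 ^ D * ((a {})\<^sup>2)\<^sup>2"
    by (simp add: mult_le_cancel_right1)
  then show ?case
    by (simp add: cube_avg_def walsh_poly_def)
next
  case (insert j V)
  define b where "b T = a (insert j T)" for T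
  define u where "u = walsh_poly a V"
  define w where "w = walsh_poly b V"
  define U where "U = (\<Sum>T\<in>Pow V. (a T)\<^sup>2)"
  define W where "W = (\<Sum>T\<in>Pow V. (b T)\<^sup>2)"
  have nonneg: "0 \<le> U" "0 \<le> W" by (auto simp: U_def W_def intro: sum_nonneg)
  have UW: "(\<Sum>T\<in>Pow (insert j V). (a T)\<^sup>2) = U + W"
    using insert.hyps by (simp add: sum_Pow_insert U_def W_def b_def)
  have u4: "cube_avg V (\<lambda>y. u y ^ 4) \<le> 9 ^ D * U\<^sup>2"
    unfolding u_def U_def using insert.prems by (intro insert.IH) auto
  have split: "walsh_poly a (insert j V) y = u y + y j * w y" for y
    unfolding u_def w_def b_def using insert.hyps by (rule walsh_poly_insert)
  have upd: "u (y(j := t)) = u y" "w (y(j := t)) = w y" for y t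
    unfolding u_def w_def using insert.hyps by (auto intro!: walsh_poly_cong)
  have "cube_avg (insert j V) (\<lambda>y. walsh_poly a (insert j V) y ^ 4)
      = (cube_avg V (\<lambda>y. (u y + w y) ^ 4) + cube_avg V (\<lambda>y. (u y - w y) ^ 4)) / 2"
    unfolding cube_avg_insert [OF insert.hyps] split upd
    using insert.hyps by (intro arg_cong2 [where f = "\<lambda>a b. (a + b) / 2"] cube_avg_cong) (auto simp: sign_vec_def)
  also have "\<dots> = cube_avg V (\<lambda>y. (1/2) * ((u y + w y) ^ 4 + (u y - w y) ^ 4))"
    unfolding cube_avg_cmult cube_avg_add by simp
  also have "\<dots> = cube_avg V (\<lambda>y. u y ^ 4 + (6 * ((u y)\<^sup>2 * (w y)\<^sup>2) + w y ^ 4))"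
    by (intro cube_avg_cong) (simp add: power4_eq_xxxx power2_eq_square algebra_simps)
  also have "\<dots> = cube_avg V (\<lambda>y. u y ^ 4) + (6 * cube_avg V (\<lambda>y. (u y)\<^sup>2 * (w y)\<^sup>2) + cube_avg V (\<lambda>y. w y ^ 4))"
    unfolding cube_avg_add cube_avg_cmult ..
  also have "\<dots> \<le> 9 ^ D * (U + W)\<^sup>2"
  proof (cases D)
    case 0
    \<comment> \<open>Degree 0 leaves no term containing \<open>j\<close>, so \<open>w\<close>
      vanishes and no exponent \<open>D - 1\<close> is called for.\<close>
    have "b T = 0" if "T \<subseteq> V" for T
      using that insert finite_subset [OF that] 0 by (auto simp: b_def card_insert_if intro!: insert.prems)
    then have "w = (\<lambda>y. 0)" "W = 0"
      by (auto simp: w_def walsh_poly_def W_def)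
    then show ?thesis
      using u4 0 by (simp add: cube_avg_def)
  next
    case (Suc E)
    have w4: "cube_avg V (\<lambda>y. w y ^ 4) \<le> 9 ^ E * W\<^sup>2"
      unfolding w_def W_def
    proof (rule insert.IH)
      fix T assume "T \<subseteq> V" "E < card T"
      then show "b T = 0"
        using insert Suc finite_subset [of T V] by (auto simp: b_def card_insert_if intro!: insert.prems)
    qed
    have "(cube_avg V (\<lambda>y. (u y)\<^sup>2 * (w y)\<^sup>2))\<^sup>2 \<le> cube_avg V (\<lambda>y. u y ^ 4) * cube_avg V (\<lambda>y. w y ^ 4)"
      using cube_avg_Cauchy_Schwarz [of V "\<lambda>y. (u y)\<^sup>2" "\<lambda>y. (w y)\<^sup>2"] by simp
    also have "\<dots> \<le> (9 ^ D * U\<^sup>2) * (9 ^ E * W\<^sup>2)"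
      by (intro mult_mono u4 w4 cube_avg_nonneg) auto
    also have "\<dots> = (9 ^ E * 3 * U * W)\<^sup>2"
      by (simp add: Suc power2_eq_square)
    finally have "cube_avg V (\<lambda>y. (u y)\<^sup>2 * (w y)\<^sup>2) \<le> 9 ^ E * 3 * U * W"
      by (rule power2_le_imp_le) (use nonneg in auto)
    then have "cube_avg V (\<lambda>y. u y ^ 4) + (6 * cube_avg V (\<lambda>y. (u y)\<^sup>2 * (w y)\<^sup>2) + cube_avg V (\<lambda>y. w y ^ 4))
        \<le> 9 ^ D * U\<^sup>2 + (6 * (9 ^ E * 3 * U * W) + 9 ^ E * W\<^sup>2)"
      using u4 w4 by linarith
    also have "\<dots> \<le> 9 ^ D * (U + W)\<^sup>2"
      using nonneg by (simp add: Suc power2_eq_square algebra_simps)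
    finally show ?thesis .
  qed
  finally show ?case
    unfolding UW .
qed

subsection \<open>Weighted means, interpolation and hypercontractivity\<close>

text \<open>Concavity of the logarithm, used through its tangent line at the weighted mean
  \<open>A\<close>.\<close>

lemma weighted_am_gm_3:
  fixes u v w :: real
  assumes pos: "0 < u" "0 < v" "0 < w"
    and wts: "0 \<le> \<alpha>" "0 \<le> \<beta>" "0 \<le> \<gamma>" "\<alpha> + \<beta> + \<gamma> = 1"
  shows "u powr \<alpha> * v powr \<beta> * w powr \<gamma> \<le> \<alpha> * u + \<beta> * v + \<gamma> * w"
proof -
  define A where "A = \<alpha> * u + \<beta> * v + \<gamma> * w"
  have "0 < \<alpha> \<or> 0 < \<beta> \<or> 0 < \<gamma>"
    using wts by linarith
  then have "0 < \<alpha> * u \<or> 0 < \<beta> * v \<or> 0 < \<gamma> * w"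
    using pos by auto
  moreover have "0 \<le> \<alpha> * u" "0 \<le> \<beta> * v" "0 \<le> \<gamma> * w"
    using pos wts by auto
  ultimately have A: "0 < A"
    unfolding A_def by linarith
  have ln_le: "ln t \<le> ln A + (t / A - 1)" if "0 < t" for t
    using ln_le_minus_one [of "t / A"] that A by (simp add: ln_div)
  have "\<alpha> * ln u + \<beta> * ln v + \<gamma> * ln w
      \<le> \<alpha> * (ln A + (u / A - 1)) + \<beta> * (ln A + (v / A - 1)) + \<gamma> * (ln A + (w / A - 1))"
    using pos wts by (intro add_mono mult_left_mono ln_le) auto
  also have "\<dots> = (\<alpha> + \<beta> + \<gamma>) * (ln A - 1) + (\<alpha> * u + \<beta> * v + \<gamma> * w) / A"
    by (simp add: algebra_simps add_divide_distrib)
  also have "\<dots> = ln A"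
    using A wts by (simp flip: A_def)
  finally have "exp (\<alpha> * ln u + \<beta> * ln v + \<gamma> * ln w) \<le> exp (ln A)"
    by (simp only: exp_le_cancel_iff)
  then show ?thesis
    using pos A by (simp add: A_def powr_def exp_add)
qed

text \<open>Dividing each family by its sum reduces the claim to the weighted AM-GM inequality in
  every index.\<close>

lemma Holder_3:
  fixes x y z :: "'a \<Rightarrow> real"
  assumes nonneg: "\<And>i. i \<in> I \<Longrightarrow> 0 \<le> x i" "\<And>i. i \<in> I \<Longrightarrow> 0 \<le> y i" "\<And>i. i \<in> I \<Longrightarrow> 0 \<le> z i"
    and wts: "0 \<le> \<alpha>" "0 \<le> \<beta>" "0 \<le> \<gamma>" "\<alpha> + \<beta> + \<gamma> = 1"
  shows "(\<Sum>i\<in>I. x i powr \<alpha> * y i powr \<beta> * z i powr \<gamma>) \<le> sum x I powr \<alpha> * sum y I powr \<beta> * sum z I powr \<gamma>"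
proof (cases "finite I")
  case True
  define X Y Z where "X = sum x I" and "Y = sum y I" and "Z = sum z I"
  have XYZ: "0 \<le> X" "0 \<le> Y" "0 \<le> Z"
    unfolding X_def Y_def Z_def using nonneg by (auto intro: sum_nonneg)
  have "(\<Sum>i\<in>I. x i powr \<alpha> * y i powr \<beta> * z i powr \<gamma>)
     \<le> (\<Sum>i\<in>I. (X powr \<alpha> * Y powr \<beta> * Z powr \<gamma>) * (\<alpha> * (x i / X) + \<beta> * (y i / Y) + \<gamma> * (z i / Z)))"
  proof (rule sum_mono)
    fix i assume i: "i \<in> I"
    show "x i powr \<alpha> * y i powr \<beta> * z i powr \<gamma>
      \<le> (X powr \<alpha> * Y powr \<beta> * Z powr \<gamma>) * (\<alpha> * (x i / X) + \<beta> * (y i / Y) + \<gamma> * (z i / Z))"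
    proof (cases "x i = 0 \<or> y i = 0 \<or> z i = 0")
      \<comment> \<open>The left side vanishes even when the vanishing factor carries weight 0,
        because \<open>0 powr 0 = 0\<close>.\<close>
      case True
      have "0 \<le> (X powr \<alpha> * Y powr \<beta> * Z powr \<gamma>) * (\<alpha> * (x i / X) + \<beta> * (y i / Y) + \<gamma> * (z i / Z))"
        using nonneg i wts XYZ by (intro mult_nonneg_nonneg add_nonneg_nonneg) auto
      with True show ?thesis by (elim disjE) auto
    next
      case False
      then have pos: "0 < x i" "0 < y i" "0 < z i"
        using nonneg i by (auto simp: order_less_le)
      moreover have "x i \<le> X" "y i \<le> Y" "z i \<le> Z"
        unfolding X_def Y_def Z_def using nonneg i \<open>finite I\<close> by (auto intro!: member_le_sum)
      ultimately have pos': "0 < X" "0 < Y" "0 < Z" by auto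
      have "x i powr \<alpha> * y i powr \<beta> * z i powr \<gamma>
          = (X powr \<alpha> * Y powr \<beta> * Z powr \<gamma>) * ((x i / X) powr \<alpha> * (y i / Y) powr \<beta> * (z i / Z) powr \<gamma>)"
        using pos pos' by (simp add: powr_divide)
      also have "\<dots> \<le> (X powr \<alpha> * Y powr \<beta> * Z powr \<gamma>) * (\<alpha> * (x i / X) + \<beta> * (y i / Y) + \<gamma> * (z i / Z))"
        using pos pos' wts by (intro mult_left_mono weighted_am_gm_3) auto
      finally show ?thesis .
    qed
  qed
  also have "\<dots> = (X powr \<alpha> * Y powr \<beta> * Z powr \<gamma>) * (\<alpha> * (X / X) + \<beta> * (Y / Y) + \<gamma> * (Z / Z))"
    by (simp add: sum.distrib X_def Y_def Z_def flip: sum_distrib_left sum_divide_distrib)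
  \<comment> \<open>Only an inequality, since a sum equal to 0 makes the quotient 0 instead of
    1.\<close>
  also have "\<dots> \<le> (X powr \<alpha> * Y powr \<beta> * Z powr \<gamma>) * (\<alpha> * 1 + \<beta> * 1 + \<gamma> * 1)"
    using wts by (intro mult_left_mono add_mono) auto
  finally show ?thesis
    using wts by (simp add: X_def Y_def Z_def)
qed simp

lemma cube_avg_Holder_3:
  assumes nonneg: "\<And>v. 0 \<le> x v" "\<And>v. 0 \<le> y v" "\<And>v. 0 \<le> z v"
    and wts: "0 \<le> \<alpha>" "0 \<le> \<beta>" "0 \<le> \<gamma>" "\<alpha> + \<beta> + \<gamma> = 1"
  shows "cube_avg V (\<lambda>v. x v powr \<alpha> * y v powr \<beta> * z v powr \<gamma>)
      \<le> cube_avg V x powr \<alpha> * cube_avg V y powr \<beta> * cube_avg V z powr \<gamma>"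
proof -
  define N :: real where "N = 2 ^ card V"
  have N: "0 < N" by (simp add: N_def)
  have "N powr \<alpha> * N powr \<beta> * N powr \<gamma> = N"
    using N wts by (simp flip: powr_add)
  then show ?thesis
    using Holder_3 [of "Pow V" "\<lambda>Y. x (sign_vec Y)" "\<lambda>Y. y (sign_vec Y)" "\<lambda>Y. z (sign_vec Y)", OF nonneg wts] N
    unfolding cube_avg_def by (simp add: powr_divide sum_nonneg nonneg divide_right_mono flip: N_def)
qed

text \<open>Half the Bohnenblust--Hille exponent, as it is applied to squared coefficients.\<close>

definition bh_exp :: "nat \<Rightarrow> real" where
  "bh_exp k = real k / (real k + 1)"

lemma sq_powr:
  fixes t :: real
  shows "t\<^sup>2 = \<bar>t\<bar> powr 2" "t ^ 4 = \<bar>t\<bar> powr 4"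
  by simp_all

text \<open>The polynomial may have arbitrary degree; only the part selected by \<open>\<T>\<close> has low degree. Testing against
  that part (duality) puts the hypercontractive estimate on the low-degree side.\<close>

lemma restricted_l2_le:
  assumes V: "finite V" and TV: "\<T> \<subseteq> Pow V" and card: "\<And>T. T \<in> \<T> \<Longrightarrow> card T \<le> 2 * k" and k: "2 \<le> k"
  shows "((\<Sum>T\<in>\<T>. (a T)\<^sup>2) / 81) powr bh_exp k \<le> cube_avg V (\<lambda>y. (walsh_poly a V y)\<^sup>2 powr bh_exp k)"
proof -
  define U where "U = (\<Sum>T\<in>\<T>. (a T)\<^sup>2)"
  define X where "X = cube_avg V (\<lambda>y. (walsh_poly a V y)\<^sup>2 powr bh_exp k)"
  define h where "h y = (\<Sum>T\<in>\<T>. a T * walsh T y)" for y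
  define b where "b T = (if T \<in> \<T> then a T else 0)" for T
  \<comment> \<open>The weights solve \<open>2 * bh_exp k * \<alpha> = 1\<close>,
    \<open>2 * \<beta> + 4 * \<gamma> = 1\<close> and
    \<open>\<alpha> + \<beta> + \<gamma> = 1\<close>. Nonnegativity of \<open>\<beta>\<close> is
    where \<open>2 \<le> k\<close> enters.\<close>
  define \<alpha> \<beta> \<gamma> where "\<alpha> = (real k + 1) / (2 * k)" and "\<beta> = (real k - 2) / (2 * k)" and "\<gamma> = 1 / (2 * real k)"
  have h_eq: "h y = walsh_poly b V y" for y
    unfolding h_def walsh_poly_def b_def using V TV by (intro sum.mono_neutral_cong_left) auto
  have U_eq: "U = (\<Sum>T\<in>Pow V. (b T)\<^sup>2)"
    unfolding U_def b_def using V TV by (intro sum.mono_neutral_cong_left) auto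
  have U_nonneg: "0 \<le> U" and X_nonneg: "0 \<le> X"
    by (auto simp: U_def X_def intro: sum_nonneg cube_avg_nonneg)
  have wts: "0 \<le> \<alpha>" "0 \<le> \<beta>" "0 \<le> \<gamma>" "\<alpha> + \<beta> + \<gamma> = 1"
    using k by (auto simp: \<alpha>_def \<beta>_def \<gamma>_def field_simps)
  have pw: "g * t \<le> (g\<^sup>2 powr bh_exp k) powr \<alpha> * t\<^sup>2 powr \<beta> * (t ^ 4) powr \<gamma>" for g t :: real
  proof (cases "g = 0 \<or> t = 0")
    case False
    have "2 * bh_exp k * \<alpha> = 1"
      using k by (simp add: bh_exp_def \<alpha>_def)
    then have "(g\<^sup>2 powr bh_exp k) powr \<alpha> = \<bar>g\<bar> powr 1"
      unfolding sq_powr by (simp add: powr_powr del: powr_numeral)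
    moreover have "t\<^sup>2 powr \<beta> * (t ^ 4) powr \<gamma> = \<bar>t\<bar> powr (2 * \<beta> + 4 * \<gamma>)"
      unfolding sq_powr by (simp add: powr_powr powr_add del: powr_numeral)
    moreover have "2 * \<beta> + 4 * \<gamma> = 1"
      using k by (simp add: \<beta>_def \<gamma>_def field_simps)
    ultimately show ?thesis
      using False by (simp add: mult.assoc flip: abs_mult)
  qed auto
  have "U = cube_avg V (\<lambda>y. walsh_poly a V y * h y)"
    using cube_avg_inner [OF V TV, of a a] by (simp add: U_def h_def power2_eq_square mult.commute)
  also have "\<dots> \<le> cube_avg V (\<lambda>y. ((walsh_poly a V y)\<^sup>2 powr bh_exp k) powr \<alpha> * (h y)\<^sup>2 powr \<beta> * (h y ^ 4) powr \<gamma>)"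
    by (intro cube_avg_mono pw)
  also have "\<dots> \<le> X powr \<alpha> * cube_avg V (\<lambda>y. (h y)\<^sup>2) powr \<beta> * cube_avg V (\<lambda>y. h y ^ 4) powr \<gamma>"
    unfolding X_def by (intro cube_avg_Holder_3 wts) auto
  also have "cube_avg V (\<lambda>y. (h y)\<^sup>2) = U"
    unfolding h_eq U_eq by (rule cube_avg_parseval [OF V])
  \<comment> \<open>Degree at most \<open>2 * k\<close> costs 9^(2k) = 81^k, and the power
    \<open>\<gamma> = 1 / (2 * k)\<close> reduces this to the square root of 81 for every
    \<open>k\<close>.\<close>
  also have "cube_avg V (\<lambda>y. h y ^ 4) powr \<gamma> \<le> (81 ^ k * U\<^sup>2) powr \<gamma>"
  proof (rule powr_mono2)
    have "cube_avg V (\<lambda>y. h y ^ 4) \<le> 9 ^ (2 * k) * U\<^sup>2"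
      unfolding h_eq U_eq using card by (intro bonami_2_4 V) (auto simp: b_def not_less [symmetric])
    then show "cube_avg V (\<lambda>y. h y ^ 4) \<le> 81 ^ k * U\<^sup>2"
      by (simp add: power_mult)
  qed (use wts in \<open>auto intro: cube_avg_nonneg\<close>)
  finally have main: "U \<le> X powr \<alpha> * U powr \<beta> * (81 ^ k * U\<^sup>2) powr \<gamma>"
    by (simp add: mult_left_mono)
  have "(U / 81) powr bh_exp k \<le> X"
  proof (cases "U = 0")
    case True
    then show ?thesis using X_nonneg by simp
  next
    case False
    with U_nonneg have U: "0 < U" by simp
    have "(81::real) ^ k = 81 powr real k" "U\<^sup>2 = U powr 2"
      using U by (simp_all add: powr_realpow)
    moreover have "real k * \<gamma> = 1 / 2" "2 * \<gamma> = 1 / k" "\<beta> + 1 / k = 1 / 2"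
      using k by (simp_all add: \<beta>_def \<gamma>_def field_simps)
    ultimately have e1: "(81 ^ k * U\<^sup>2) powr \<gamma> = 81 powr (1 / 2) * U powr (1 / k)"
      and e2: "U powr \<beta> * U powr (1 / k) = U powr (1 / 2)"
      by (simp_all only: powr_mult powr_powr powr_ge_zero powr_add [symmetric])
    have "X powr \<alpha> * U powr \<beta> * (81 ^ k * U\<^sup>2) powr \<gamma> = X powr \<alpha> * 81 powr (1 / 2) * (U powr \<beta> * U powr (1 / k))"
      unfolding e1 by (simp only: mult_ac)
    then have "X powr \<alpha> * U powr \<beta> * (81 ^ k * U\<^sup>2) powr \<gamma> = X powr \<alpha> * 81 powr (1 / 2) * U powr (1 / 2)"
      unfolding e2 .
    moreover have "U powr (1 / 2) * U powr (1 / 2) = U"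
      using U by (simp flip: powr_add)
    ultimately have "U powr (1 / 2) * U powr (1 / 2) \<le> X powr \<alpha> * 81 powr (1 / 2) * U powr (1 / 2)"
      using main by (simp only:)
    then have "U powr (1 / 2) \<le> X powr \<alpha> * 81 powr (1 / 2)"
      by (rule mult_right_le_imp_le) (use U in simp)
    then have "U powr (1 / 2) / 81 powr (1 / 2) \<le> X powr \<alpha>"
      by (subst pos_divide_le_eq) auto
    then have "(U / 81) powr (1 / 2) \<le> X powr \<alpha>"
      using U by (subst powr_divide) auto
    then have "((U / 81) powr (1 / 2)) powr (2 * bh_exp k) \<le> (X powr \<alpha>) powr (2 * bh_exp k)"
      by (intro powr_mono2) (auto simp: bh_exp_def)
    moreover have "\<alpha> * (2 * bh_exp k) = 1"
      using k by (simp add: \<alpha>_def bh_exp_def)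
    ultimately show ?thesis
      using X_nonneg by (simp add: powr_powr)
  qed
  then show ?thesis by (simp add: U_def X_def)
qed

text \<open>Hoelder interpolates the second moment between the first and the fourth; Bonami's
  inequality bounds the fourth by the square of the second, and solving for the latter gives the
  claim.\<close>

lemma l2_le_l1:
  assumes V: "finite V" and deg: "\<And>T. T \<subseteq> V \<Longrightarrow> D < card T \<Longrightarrow> a T = 0"
  shows "(\<Sum>T\<in>Pow V. (a T)\<^sup>2) powr (1 / 2) \<le> 3 ^ D * cube_avg V (\<lambda>y. \<bar>walsh_poly a V y\<bar>)"
proof -
  define U where "U = (\<Sum>T\<in>Pow V. (a T)\<^sup>2)"
  define h where "h = walsh_poly a V"
  define X where "X = cube_avg V (\<lambda>y. \<bar>h y\<bar>)"
  have U_nonneg: "0 \<le> U" and X_nonneg: "0 \<le> X"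
    by (auto simp: U_def X_def intro: sum_nonneg cube_avg_nonneg)
  \<comment> \<open>The factor \<open>1 powr 0\<close> is a dummy that fits the identity to the
    three-term Hoelder inequality with third weight 0.\<close>
  have pw: "t\<^sup>2 = \<bar>t\<bar> powr (2/3) * (t ^ 4) powr (1/3) * 1 powr 0" for t :: real
  proof (cases "t = 0")
    case False
    then have "\<bar>t\<bar> powr (2/3) * (t ^ 4) powr (1/3) = \<bar>t\<bar> powr 2"
      unfolding sq_powr by (simp add: powr_powr del: powr_numeral flip: powr_add)
    with False show ?thesis by simp
  qed auto
  have "U = cube_avg V (\<lambda>y. (h y)\<^sup>2)"
    unfolding h_def U_def by (simp add: cube_avg_parseval V)
  also have "\<dots> = cube_avg V (\<lambda>y. \<bar>h y\<bar> powr (2/3) * (h y ^ 4) powr (1/3) * 1 powr 0)"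
    using pw by simp
  also have "\<dots> \<le> X powr (2/3) * cube_avg V (\<lambda>y. h y ^ 4) powr (1/3) * cube_avg V (\<lambda>y. 1) powr 0"
    unfolding X_def by (intro cube_avg_Holder_3) auto
  also have "cube_avg V (\<lambda>y. 1) = 1"
    by (rule cube_avg_const [OF V])
  also have "cube_avg V (\<lambda>y. h y ^ 4) powr (1/3) \<le> (9 ^ D * U\<^sup>2) powr (1/3)"
    unfolding h_def U_def by (intro powr_mono2 bonami_2_4 V deg cube_avg_nonneg) auto
  finally have main: "U \<le> X powr (2/3) * (9 ^ D * U\<^sup>2) powr (1/3)"
    by (simp add: mult_left_mono)
  have "U powr (1/2) \<le> 3 ^ D * X"
  proof (cases "U = 0")
    case True
    then show ?thesis using X_nonneg by simp
  next
    case False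
    with U_nonneg have U: "0 < U" by simp
    have e: "(9 ^ D * U\<^sup>2) powr (1/3) = (3 ^ D) powr (2/3) * U powr (2/3)"
    proof -
      have "(9::real) ^ D * U\<^sup>2 = ((3 ^ D) * U) powr 2"
        using U by (simp add: power_mult_distrib flip: power_mult) (simp add: power_mult mult.commute [of D])
      show ?thesis
        unfolding \<open>9 ^ D * U\<^sup>2 = _\<close> powr_powr by (subst powr_mult) simp_all
    qed
    have "U powr (1/3) * U powr (2/3) = U"
      using U by (simp flip: powr_add)
    moreover have "X powr (2/3) * (9 ^ D * U\<^sup>2) powr (1/3) = (3 ^ D * X) powr (2/3) * U powr (2/3)"
      using X_nonneg unfolding e by (subst powr_mult) (simp_all add: mult_ac)
    ultimately have "U powr (1/3) * U powr (2/3) \<le> (3 ^ D * X) powr (2/3) * U powr (2/3)"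
      using main by (simp only:)
    then have "U powr (1/3) \<le> (3 ^ D * X) powr (2/3)"
      by (rule mult_right_le_imp_le) (use U in simp)
    then have "(U powr (1/3)) powr (3/2) \<le> ((3 ^ D * X) powr (2/3)) powr (3/2)"
      by (intro powr_mono2) auto
    then show ?thesis
      using X_nonneg by (simp add: powr_powr)
  qed
  then show ?thesis by (simp add: U_def X_def h_def)
qed

text \<open>With row sums \<open>r\<close>, column sums \<open>s\<close> and \<open>q = bh_exp\<close>, the summand \<open>v\<^sup>q\<^sup>(\<^sup>k\<^sup>+\<^sup>l\<^sup>)\<close> is the weighted geometric mean of
  \<open>v r\<^sup>q\<^sup>(\<^sup>k\<^sup>)\<^sup>-\<^sup>1\<close>, \<open>v s\<^sup>q\<^sup>(\<^sup>l\<^sup>)\<^sup>-\<^sup>1\<close> and \<open>r\<^sup>q\<^sup>(\<^sup>k\<^sup>) s\<^sup>q\<^sup>(\<^sup>l\<^sup>)\<close> with weights proportional to \<open>k\<close>, \<open>l\<close> and 1.\<close>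

lemma sum_powr_le_3:
  fixes v :: "'a \<Rightarrow> 'b \<Rightarrow> real"
  assumes fin: "finite \<A>" "finite \<B>" and nonneg: "\<And>I J. 0 \<le> v I J"
    and rows: "(\<Sum>I\<in>\<A>. (\<Sum>J\<in>\<B>. v I J) powr bh_exp (k I)) \<le> 1"
    and cols: "(\<Sum>J\<in>\<B>. (\<Sum>I\<in>\<A>. v I J) powr bh_exp (l J)) \<le> 1"
  shows "(\<Sum>I\<in>\<A>. \<Sum>J\<in>\<B>. v I J powr bh_exp (k I + l J)) \<le> 3"
proof -
  define r where "r I = (\<Sum>J\<in>\<B>. v I J)" for I
  define s where "s J = (\<Sum>I\<in>\<A>. v I J)" for J
  have pw: "v I J powr bh_exp (k I + l J)
      \<le> v I J * r I powr (bh_exp (k I) - 1) + v I J * s J powr (bh_exp (l J) - 1)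
        + r I powr bh_exp (k I) * s J powr bh_exp (l J)" if "I \<in> \<A>" "J \<in> \<B>" for I J
  proof (cases "v I J = 0")
    case True
    then show ?thesis by simp
  next
    case False
    define t K L where "t = v I J" and "K = real (k I)" and "L = real (l J)"
    have t: "0 < t" using False nonneg [of I J] by (simp add: t_def)
    have "t \<le> r I" "t \<le> s J"
      unfolding t_def r_def s_def using that fin nonneg
      by (auto intro!: member_le_sum [where f = "\<lambda>J. v I J"] member_le_sum [where f = "\<lambda>I. v I J"])
    with t have rs: "0 < r I" "0 < s J" by auto
    define N where "N = K + L + 1"
    have KLN: "0 \<le> K" "0 \<le> L" "0 < N" by (auto simp: K_def L_def N_def)
    have "K / (K + 1) - 1 = - 1 / (K + 1)" "L / (L + 1) - 1 = - 1 / (L + 1)"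
      using KLN by (simp_all add: field_simps)
    \<comment> \<open>In the geometric mean the powers of \<open>r I\<close> and \<open>s J\<close>
      cancel, and \<open>t\<close> keeps the exponent \<open>bh_exp (k I + l J)\<close>.\<close>
    then have ex: "K / N + L / N = (K + L) / (K + L + 1)"
      "(K / (K + 1) - 1) * (K / N) + K / (K + 1) * (1 / N) = 0"
      "(L / (L + 1) - 1) * (L / N) + L / (L + 1) * (1 / N) = 0"
      by (simp_all add: N_def add_divide_distrib)
    have "(t * r I powr a) powr b * (t * s J powr c) powr d * (r I powr e * s J powr f) powr g
        = t powr (b + d) * r I powr (a * b + e * g) * s J powr (c * d + f * g)" for a b c d e f g
    proof -
      have "(t * r I powr a) powr b = t powr b * r I powr (a * b)"
        "(t * s J powr c) powr d = t powr d * s J powr (c * d)"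
        "(r I powr e * s J powr f) powr g = r I powr (e * g) * s J powr (f * g)"
        using t rs by (simp_all add: powr_mult powr_powr)
      then show ?thesis
        by (simp only: powr_add mult_ac)
    qed
    then have "t powr ((K + L) / (K + L + 1))
       = (t * r I powr (K / (K + 1) - 1)) powr (K / N) * (t * s J powr (L / (L + 1) - 1)) powr (L / N)
          * (r I powr (K / (K + 1)) * s J powr (L / (L + 1))) powr (1 / N)"
      using rs by (simp only: ex) simp
    also have "\<dots> \<le> (K / N) * (t * r I powr (K / (K + 1) - 1)) + (L / N) * (t * s J powr (L / (L + 1) - 1))
          + (1 / N) * (r I powr (K / (K + 1)) * s J powr (L / (L + 1)))"
    proof (rule weighted_am_gm_3)
      show "K / N + L / N + 1 / N = 1"
        using KLN by (simp add: N_def flip: add_divide_distrib)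
    qed (use t rs KLN in auto)
    also have "\<dots> \<le> 1 * (t * r I powr (K / (K + 1) - 1)) + 1 * (t * s J powr (L / (L + 1) - 1))
          + 1 * (r I powr (K / (K + 1)) * s J powr (L / (L + 1)))"
      using t rs KLN by (intro add_mono mult_right_mono) (auto simp: N_def)
    finally show ?thesis
      by (simp add: bh_exp_def K_def L_def t_def)
  qed
  have collapse: "u * u powr (e - 1) = u powr e" if "0 \<le> u" for u e :: real
    using that by (cases "u = 0") (auto simp: powr_diff)
  have rs_nonneg: "0 \<le> r I" "0 \<le> s J" for I J
    unfolding r_def s_def by (auto intro: sum_nonneg nonneg)
  have "(\<Sum>I\<in>\<A>. \<Sum>J\<in>\<B>. v I J powr bh_exp (k I + l J))
     \<le> (\<Sum>I\<in>\<A>. \<Sum>J\<in>\<B>. v I J * r I powr (bh_exp (k I) - 1) + v I J * s J powr (bh_exp (l J) - 1)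
        + r I powr bh_exp (k I) * s J powr bh_exp (l J))"
    by (intro sum_mono pw)
  also have "\<dots> = (\<Sum>I\<in>\<A>. \<Sum>J\<in>\<B>. v I J * r I powr (bh_exp (k I) - 1))
      + (\<Sum>J\<in>\<B>. \<Sum>I\<in>\<A>. v I J * s J powr (bh_exp (l J) - 1))
      + (\<Sum>I\<in>\<A>. \<Sum>J\<in>\<B>. r I powr bh_exp (k I) * s J powr bh_exp (l J))"
    unfolding sum.distrib by (subst (2) sum.swap) simp
  also have "(\<Sum>I\<in>\<A>. \<Sum>J\<in>\<B>. v I J * r I powr (bh_exp (k I) - 1)) = (\<Sum>I\<in>\<A>. r I powr bh_exp (k I))"
    by (intro sum.cong refl, subst sum_distrib_right [symmetric], subst r_def [symmetric], rule collapse, rule rs_nonneg)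
  also have "(\<Sum>J\<in>\<B>. \<Sum>I\<in>\<A>. v I J * s J powr (bh_exp (l J) - 1)) = (\<Sum>J\<in>\<B>. s J powr bh_exp (l J))"
    by (intro sum.cong refl, subst sum_distrib_right [symmetric], subst s_def [symmetric], rule collapse, rule rs_nonneg)
  also have "(\<Sum>I\<in>\<A>. \<Sum>J\<in>\<B>. r I powr bh_exp (k I) * s J powr bh_exp (l J))
      = (\<Sum>I\<in>\<A>. r I powr bh_exp (k I)) * (\<Sum>J\<in>\<B>. s J powr bh_exp (l J))"
    by (rule sum_product [symmetric])
  also have "(\<Sum>I\<in>\<A>. r I powr bh_exp (k I)) + (\<Sum>J\<in>\<B>. s J powr bh_exp (l J))
      + (\<Sum>I\<in>\<A>. r I powr bh_exp (k I)) * (\<Sum>J\<in>\<B>. s J powr bh_exp (l J)) \<le> 1 + 1 + 1 * 1"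
    using rows cols unfolding r_def s_def by (intro add_mono mult_mono) (auto intro: sum_nonneg)
  finally show ?thesis by simp
qed

subsection \<open>Bounded polynomials and their restrictions\<close>

text \<open>The bound is imposed on the solid cube, not only on its vertices, so that a block of
  coordinates may be scaled by a factor in [-1, 1].\<close>

definition bounded_deg :: "nat \<Rightarrow> nat set \<Rightarrow> (nat set \<Rightarrow> real) \<Rightarrow> bool" where
  "bounded_deg m V c \<longleftrightarrow> finite V \<and> (\<forall>S\<subseteq>V. m < card S \<longrightarrow> c S = 0)
     \<and> (\<forall>x. (\<forall>j. \<bar>x j\<bar> \<le> 1) \<longrightarrow> \<bar>walsh_poly c V x\<bar> \<le> 1)"

text \<open>For \<open>I\<close> disjoint from \<open>B\<close>: the coefficient at \<open>I\<close>
  after the coordinates in \<open>B\<close> are frozen at \<open>y\<close>.\<close>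

definition restr :: "(nat set \<Rightarrow> real) \<Rightarrow> nat set \<Rightarrow> (nat \<Rightarrow> real) \<Rightarrow> nat set \<Rightarrow> real" where
  "restr c B y I = walsh_poly (\<lambda>T. c (I \<union> T)) B y"

lemma bounded_degD:
  assumes "bounded_deg m V c"
  shows "finite V" "\<And>S. S \<subseteq> V \<Longrightarrow> m < card S \<Longrightarrow> c S = 0" "\<And>x. (\<And>j. \<bar>x j\<bar> \<le> 1) \<Longrightarrow> \<bar>walsh_poly c V x\<bar> \<le> 1"
  using assms by (auto simp: bounded_deg_def)

lemma walsh_poly_split:
  assumes "finite A" "finite B" "A \<inter> B = {}"
  shows "walsh_poly c (A \<union> B) x = (\<Sum>I\<in>Pow A. \<Sum>T\<in>Pow B. c (I \<union> T) * (walsh I x * walsh T x))"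
proof -
  have "walsh (I \<union> T) x = walsh I x * walsh T x" if "I \<subseteq> A" "T \<subseteq> B" for I T
    using that assms by (intro walsh_Un finite_subset [OF that(1)] finite_subset [OF that(2)]) auto
  then show ?thesis
    unfolding walsh_poly_def using assms by (simp add: sum_Pow_Un)
qed

lemma walsh_poly_restr:
  assumes "finite A" "finite B" "A \<inter> B = {}"
  shows "walsh_poly (restr c B y) A x = walsh_poly c (A \<union> B) (\<lambda>j. if j \<in> B then y j else x j)"
proof -
  have "walsh I (\<lambda>j. if j \<in> B then y j else x j) = walsh I x" if "I \<in> Pow A" for I
    using that assms by (intro walsh_cong) auto
  moreover have "walsh T (\<lambda>j. if j \<in> B then y j else x j) = walsh T y" if "T \<in> Pow B" for T
    using that by (intro walsh_cong) auto
  ultimately show ?thesis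
    unfolding walsh_poly_split [OF assms]
    by (simp add: walsh_poly_def [of "restr c B y"] restr_def walsh_poly_def sum_distrib_left mult_ac)
qed

lemma bounded_deg_restr:
  assumes c: "bounded_deg m (A \<union> B) c" and "A \<inter> B = {}" and y: "\<And>j. \<bar>y j\<bar> \<le> 1"
  shows "bounded_deg m A (restr c B y)"
proof -
  have fin: "finite A" "finite B" using bounded_degD(1) [OF c] by auto
  have "restr c B y I = 0" if "I \<subseteq> A" "m < card I" for I
  proof -
    have "c (I \<union> T) = 0" if "T \<subseteq> B" for T
    proof (rule bounded_degD(2) [OF c])
      show "m < card (I \<union> T)"
        using \<open>I \<subseteq> A\<close> \<open>m < card I\<close> that fin finite_subset
        by (intro less_le_trans [OF \<open>m < card I\<close> card_mono]) auto
    qed (use \<open>I \<subseteq> A\<close> that in auto)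
    then show ?thesis
      by (simp add: restr_def walsh_poly_def)
  qed
  moreover have "\<bar>walsh_poly (restr c B y) A x\<bar> \<le> 1" if "\<And>j. \<bar>x j\<bar> \<le> 1" for x
    unfolding walsh_poly_restr [OF fin \<open>A \<inter> B = {}\<close>] using that y by (intro bounded_degD(3) [OF c]) auto
  ultimately show ?thesis
    using fin by (auto simp: bounded_deg_def)
qed

text \<open>Scaling the block \<open>B\<close> by \<open>s\<close> gives a univariate polynomial in
  \<open>s\<close>, bounded by 1 on [-1, 1], whose coefficient at \<open>t\<close> is the part of
  degree \<open>t\<close> in \<open>B\<close>. The bound \<open>E\<close> is kept abstract to serve
  both \<open>t = 1\<close> and \<open>t = 2\<close>.\<close>

lemma abs_walsh_poly_level_le:
  assumes c: "bounded_deg m (A \<union> B) c" and "A \<inter> B = {}"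
    and E: "\<And>p. degree p \<le> m \<Longrightarrow> (\<And>s. \<bar>s\<bar> \<le> 1 \<Longrightarrow> \<bar>poly p s\<bar> \<le> 1) \<Longrightarrow> \<bar>coeff p t\<bar> \<le> E"
    and x: "\<And>j. \<bar>x j\<bar> \<le> 1"
  shows "\<bar>walsh_poly (\<lambda>S. if card (S \<inter> B) = t then c S else 0) (A \<union> B) x\<bar> \<le> E"
proof -
  define V where "V = A \<union> B"
  have fin: "finite V" using bounded_degD(1) [OF c] by (simp add: V_def)
  define p where "p = (\<Sum>S\<in>Pow V. monom (c S * walsh S x) (card (S \<inter> B)))"
  have "degree p \<le> m"
    unfolding p_def
  proof (rule degree_sum_le)
    fix S assume S: "S \<in> Pow V"
    have "c S = 0" if "m < card (S \<inter> B)"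
    proof (rule bounded_degD(2) [OF c])
      show "m < card S"
        using that S fin finite_subset by (intro less_le_trans [OF that card_mono]) auto
    qed (use S V_def in auto)
    then show "degree (monom (c S * walsh S x) (card (S \<inter> B))) \<le> m"
      by (cases "m < card (S \<inter> B)") (auto intro: order_trans [OF degree_monom_le])
  qed (use fin in auto)
  moreover have "\<bar>poly p s\<bar> \<le> 1" if "\<bar>s\<bar> \<le> 1" for s
  proof -
    define z where "z j = (if j \<in> B then s * x j else x j)" for j
    have "walsh S z = s ^ card (S \<inter> B) * walsh S x" if "S \<in> Pow V" for S
    proof -
      have "finite S" using that fin finite_subset by auto
      have "walsh S z = (\<Prod>j\<in>S. (if j \<in> B then s else 1) * x j)"
        unfolding walsh_def z_def by (intro prod.cong) auto
      then show ?thesis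
        using \<open>finite S\<close> by (simp add: prod.distrib walsh_def prod.If_cases Int_def)
    qed
    then have "poly p s = walsh_poly c V z"
      by (simp add: p_def poly_sum poly_monom walsh_poly_def mult_ac)
    moreover have "\<bar>z j\<bar> \<le> 1" for j
      using that x [of j] by (simp add: z_def abs_mult mult_le_one)
    ultimately show ?thesis
      using bounded_degD(3) [OF c] by (simp add: V_def)
  qed
  ultimately have "\<bar>coeff p t\<bar> \<le> E" by (rule E)
  moreover have "coeff p t = walsh_poly (\<lambda>S. if card (S \<inter> B) = t then c S else 0) V x"
    unfolding p_def walsh_poly_def coeff_sum by (intro sum.cong) auto
  ultimately show ?thesis by (simp add: V_def)
qed

text \<open>The linear part, evaluated at the signs of its own coefficients, equals the sum of their
  absolute values.\<close>

lemma level_1_sum_le: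
  assumes c: "bounded_deg m V c" and m: "1 \<le> m"
  shows "(\<Sum>i\<in>V. \<bar>c {i}\<bar>) \<le> 10 * real m"
proof -
  define x where "x i = sgn (c {i})" for i
  have fin: "finite V" using bounded_degD(1) [OF c] .
  have "\<bar>walsh_poly (\<lambda>S. if card (S \<inter> V) = 1 then c S else 0) ({} \<union> V) x\<bar> \<le> 10 * real m"
    by (rule abs_walsh_poly_level_le [where m = m, OF _ _ abs_coeff_1_le])
      (use c m in \<open>auto simp: x_def abs_sgn_eq\<close>)
  also have "walsh_poly (\<lambda>S. if card (S \<inter> V) = 1 then c S else 0) ({} \<union> V) x
      = (\<Sum>S\<in>(\<lambda>i. {i}) ` V. c S * walsh S x)"
    unfolding walsh_poly_def using fin
    by (intro sum.mono_neutral_cong_right) (auto simp: card_1_singleton_iff Int_absorb2)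
  also have "\<dots> = (\<Sum>i\<in>V. \<bar>c {i}\<bar>)"
    by (subst sum.reindex) (auto simp: walsh_def x_def abs_sgn mult.commute)
  finally show ?thesis by simp
qed

text \<open>Restricting to the block \<open>A\<close> leaves a polynomial bounded by 1, whose linear coefficients are
  absolutely summable; extracting degree \<open>t\<close> in the block \<open>B\<close> first costs only the factor \<open>E\<close>.\<close>

lemma level_1_rows_le:
  assumes c: "bounded_deg m (A \<union> B) c" and AB: "A \<inter> B = {}" and m: "1 \<le> m" and E_pos: "0 < E"
    and E: "\<And>p. degree p \<le> m \<Longrightarrow> (\<And>s. \<bar>s\<bar> \<le> 1 \<Longrightarrow> \<bar>poly p s\<bar> \<le> 1) \<Longrightarrow> \<bar>coeff p t\<bar> \<le> E"
  shows "(\<Sum>i\<in>A. (\<Sum>T\<in>Pow B. if card T = t then (c (insert i T))\<^sup>2 else 0) powr (1/2)) \<le> 3 ^ t * (10 * real m * E)"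
proof -
  \<comment> \<open>Division by \<open>E\<close> makes the extracted part bounded by 1 again, so it
    may be restricted like any other polynomial.\<close>
  define d where "d S = (if card (S \<inter> B) = t then c S else 0) / E" for S
  have fin: "finite A" "finite B" using bounded_degD(1) [OF c] by auto
  have d: "bounded_deg m (A \<union> B) d"
  proof -
    have "walsh_poly d (A \<union> B) x = walsh_poly (\<lambda>S. if card (S \<inter> B) = t then c S else 0) (A \<union> B) x / E" for x
      by (simp add: walsh_poly_def d_def sum_divide_distrib)
    moreover have "\<bar>walsh_poly (\<lambda>S. if card (S \<inter> B) = t then c S else 0) (A \<union> B) x\<bar> \<le> E" if "\<And>j. \<bar>x j\<bar> \<le> 1" for x
      by (rule abs_walsh_poly_level_le [OF c AB E that])
    ultimately show ?thesis
      using c E_pos by (auto simp: bounded_deg_def d_def)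
  qed
  \<comment> \<open>As a function on \<open>B\<close> the selected part has degree at most
    \<open>t\<close>; this is the source of the factor \<open>3 ^ t\<close>.\<close>
  have row: "(\<Sum>T\<in>Pow B. if card T = t then (c (insert i T))\<^sup>2 else 0) powr (1/2)
      \<le> 3 ^ t * (E * cube_avg B (\<lambda>y. \<bar>restr d B y {i}\<bar>))" if "i \<in> A" for i
  proof -
    define a where "a T = (if card T = t then c (insert i T) else 0)" for T
    have "(\<Sum>T\<in>Pow B. (a T)\<^sup>2) powr (1 / 2) \<le> 3 ^ t * cube_avg B (\<lambda>y. \<bar>walsh_poly a B y\<bar>)"
      by (rule l2_le_l1 [OF fin(2)]) (auto simp: a_def)
    moreover have "(\<Sum>T\<in>Pow B. (a T)\<^sup>2) = (\<Sum>T\<in>Pow B. if card T = t then (c (insert i T))\<^sup>2 else 0)"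
      by (intro sum.cong) (auto simp: a_def)
    moreover have "\<bar>walsh_poly a B y\<bar> = E * \<bar>restr d B y {i}\<bar>" for y
    proof -
      have "insert i T \<inter> B = T" if "T \<subseteq> B" for T
        using that \<open>i \<in> A\<close> AB by auto
      then have "walsh_poly a B y = E * restr d B y {i}"
        unfolding restr_def walsh_poly_def sum_distrib_left
        using E_pos by (intro sum.cong) (auto simp: a_def d_def)
      then show ?thesis
        using E_pos by (simp add: abs_mult)
    qed
    ultimately show ?thesis
      by (simp add: cube_avg_cmult)
  qed
  have "(\<Sum>i\<in>A. (\<Sum>T\<in>Pow B. if card T = t then (c (insert i T))\<^sup>2 else 0) powr (1/2))
      \<le> (\<Sum>i\<in>A. 3 ^ t * (E * cube_avg B (\<lambda>y. \<bar>restr d B y {i}\<bar>)))"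
    by (intro sum_mono row)
  also have "\<dots> = 3 ^ t * (E * cube_avg B (\<lambda>y. \<Sum>i\<in>A. \<bar>restr d B y {i}\<bar>))"
    unfolding cube_avg_sum by (simp add: sum_distrib_left)
  also have "cube_avg B (\<lambda>y. \<Sum>i\<in>A. \<bar>restr d B y {i}\<bar>) \<le> cube_avg B (\<lambda>y. 10 * real m)"
    using d AB m by (intro cube_avg_mono level_1_sum_le bounded_deg_restr) auto
  also have "\<dots> = 10 * real m"
    by (rule cube_avg_const [OF fin(2)])
  finally show ?thesis
    using E_pos by (simp add: mult_ac)
qed

subsection \<open>The Bohnenblust--Hille inequality\<close>

text \<open>For \<open>\<Lambda> = {d}\<close> this is the Bohnenblust--Hille inequality at level \<open>d\<close> with constant \<open>\<surd>M\<close>; a larger \<open>\<Lambda>\<close>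
  controls the sum over several levels, each with its own exponent.\<close>

definition BH :: "nat \<Rightarrow> nat set \<Rightarrow> real \<Rightarrow> bool" where
  "BH m \<Lambda> M \<longleftrightarrow> (\<forall>V c. bounded_deg m V c \<longrightarrow>
     (\<Sum>S | S \<subseteq> V \<and> card S \<in> \<Lambda>. ((c S)\<^sup>2 / M) powr bh_exp (card S)) \<le> 1)"

lemma BH_D:
  "BH m \<Lambda> M \<Longrightarrow> bounded_deg m V c \<Longrightarrow>
     (\<Sum>S | S \<subseteq> V \<and> card S \<in> \<Lambda>. ((c S)\<^sup>2 / M) powr bh_exp (card S)) \<le> 1"
  by (auto simp: BH_def)

text \<open>In \<open>BH\<close> the constant sits inside the power, so a bound \<open>X\<close> on
  the sum is absorbed by enlarging \<open>M\<close> by any \<open>\<kappa>\<close> whose powers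
  \<open>bh_exp k\<close> all reach \<open>X\<close>.\<close>

lemma BH_scaleI:
  assumes M: "0 < M" "0 < \<kappa>" and X: "0 < X" and \<Lambda>: "\<And>k. k \<in> \<Lambda> \<Longrightarrow> X \<le> \<kappa> powr bh_exp k"
    and le: "\<And>V c. bounded_deg m V c \<Longrightarrow>
       (\<Sum>S | S \<subseteq> V \<and> card S \<in> \<Lambda>. ((c S)\<^sup>2 / M) powr bh_exp (card S)) \<le> X"
  shows "BH m \<Lambda> (\<kappa> * M)"
  unfolding BH_def
proof (intro allI impI)
  fix V c assume c: "bounded_deg m V c"
  have "(\<Sum>S | S \<subseteq> V \<and> card S \<in> \<Lambda>. ((c S)\<^sup>2 / (\<kappa> * M)) powr bh_exp (card S))
     \<le> (\<Sum>S | S \<subseteq> V \<and> card S \<in> \<Lambda>. ((c S)\<^sup>2 / M) powr bh_exp (card S) / X)"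
  proof (intro sum_mono)
    fix S assume "S \<in> {S. S \<subseteq> V \<and> card S \<in> \<Lambda>}"
    then have "X \<le> \<kappa> powr bh_exp (card S)" using \<Lambda> by auto
    have "((c S)\<^sup>2 / (\<kappa> * M)) powr bh_exp (card S) = ((c S)\<^sup>2 / M) powr bh_exp (card S) / \<kappa> powr bh_exp (card S)"
      using M by (subst powr_divide [symmetric]) (auto simp: mult.commute)
    also have "\<dots> \<le> ((c S)\<^sup>2 / M) powr bh_exp (card S) / X"
      using X M \<open>X \<le> _\<close> by (intro divide_left_mono) auto
    finally show "((c S)\<^sup>2 / (\<kappa> * M)) powr bh_exp (card S) \<le> ((c S)\<^sup>2 / M) powr bh_exp (card S) / X" .
  qed
  also have "\<dots> \<le> 1"
    using le [OF c] X by (simp flip: sum_divide_distrib)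
  finally show "(\<Sum>S | S \<subseteq> V \<and> card S \<in> \<Lambda>. ((c S)\<^sup>2 / (\<kappa> * M)) powr bh_exp (card S)) \<le> 1" .
qed

lemma BH_mono:
  assumes "BH m \<Lambda>' M" "\<Lambda> \<subseteq> \<Lambda>'" "0 < M" "M \<le> M'"
  shows "BH m \<Lambda> M'"
  unfolding BH_def
proof (intro allI impI)
  fix V c assume c: "bounded_deg m V c"
  have "(\<Sum>S | S \<subseteq> V \<and> card S \<in> \<Lambda>. ((c S)\<^sup>2 / M') powr bh_exp (card S))
     \<le> (\<Sum>S | S \<subseteq> V \<and> card S \<in> \<Lambda>. ((c S)\<^sup>2 / M) powr bh_exp (card S))"
    using assms by (intro sum_mono powr_mono2 divide_left_mono) (auto simp: bh_exp_def)
  also have "\<dots> \<le> (\<Sum>S | S \<subseteq> V \<and> card S \<in> \<Lambda>'. ((c S)\<^sup>2 / M) powr bh_exp (card S))"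
    using assms bounded_degD(1) [OF c] by (intro sum_mono2) auto
  also have "\<dots> \<le> 1"
    using assms(1) c by (rule BH_D)
  finally show "(\<Sum>S | S \<subseteq> V \<and> card S \<in> \<Lambda>. ((c S)\<^sup>2 / M') powr bh_exp (card S)) \<le> 1" .
qed

text \<open>For each fixed \<open>y\<close>, \<open>BH\<close> applies to the restriction to
  \<open>A\<close>, and the bound survives averaging over \<open>y\<close>. By
  \<open>restricted_l2_le\<close>, the average for \<open>I\<close> dominates the whole row of
  \<open>I\<close> at the cost of 81.\<close>

lemma BH_rows_le:
  assumes BH: "BH m \<Lambda> M" and M: "0 < M" and \<Lambda>: "\<And>k. k \<in> \<Lambda> \<Longrightarrow> 2 \<le> k"
    and c: "bounded_deg m (A \<union> B) c" and AB: "A \<inter> B = {}"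
    and \<T>: "\<And>I. \<T> I \<subseteq> Pow B" "\<And>I T. T \<in> \<T> I \<Longrightarrow> card T \<le> 2 * card I"
  shows "(\<Sum>I | I \<subseteq> A \<and> card I \<in> \<Lambda>. ((\<Sum>T\<in>\<T> I. (c (I \<union> T))\<^sup>2) / (81 * M)) powr bh_exp (card I)) \<le> 1"
proof -
  have fin: "finite A" "finite B" using bounded_degD(1) [OF c] by auto
  have "(\<Sum>I | I \<subseteq> A \<and> card I \<in> \<Lambda>. ((\<Sum>T\<in>\<T> I. (c (I \<union> T))\<^sup>2) / (81 * M)) powr bh_exp (card I))
     \<le> (\<Sum>I | I \<subseteq> A \<and> card I \<in> \<Lambda>. cube_avg B (\<lambda>y. ((restr c B y I)\<^sup>2 / M) powr bh_exp (card I)))"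
  proof (intro sum_mono)
    fix I assume I: "I \<in> {I. I \<subseteq> A \<and> card I \<in> \<Lambda>}"
    define U where "U = (\<Sum>T\<in>\<T> I. (c (I \<union> T))\<^sup>2)"
    have "0 \<le> U" by (auto simp: U_def intro: sum_nonneg)
    have "(U / (81 * M)) powr bh_exp (card I) = (U / 81) powr bh_exp (card I) * (1 / M powr bh_exp (card I))"
      using M \<open>0 \<le> U\<close> by (simp add: powr_divide powr_mult)
    also have "\<dots> \<le> cube_avg B (\<lambda>y. (restr c B y I)\<^sup>2 powr bh_exp (card I)) * (1 / M powr bh_exp (card I))"
      unfolding U_def restr_def using I \<Lambda> \<T> fin by (intro mult_right_mono restricted_l2_le) auto
    also have "\<dots> = cube_avg B (\<lambda>y. ((restr c B y I)\<^sup>2 / M) powr bh_exp (card I))"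
      using M by (simp add: powr_divide mult.commute flip: cube_avg_cmult)
    finally show "((\<Sum>T\<in>\<T> I. (c (I \<union> T))\<^sup>2) / (81 * M)) powr bh_exp (card I)
      \<le> cube_avg B (\<lambda>y. ((restr c B y I)\<^sup>2 / M) powr bh_exp (card I))"
      by (simp add: U_def)
  qed
  also have "\<dots> = cube_avg B (\<lambda>y. \<Sum>I | I \<subseteq> A \<and> card I \<in> \<Lambda>. ((restr c B y I)\<^sup>2 / M) powr bh_exp (card I))"
    by (simp add: cube_avg_sum)
  also have "\<dots> \<le> cube_avg B (\<lambda>y. 1)"
    using c AB by (intro cube_avg_mono BH_D [OF BH] bounded_deg_restr) auto
  also have "\<dots> = 1"
    by (rule cube_avg_const [OF fin(2)])
  finally show ?thesis .
qed

section \<open>Random bipartitions and the halving step\<close>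

lemma sum_card_Pow:
  fixes g :: "nat \<Rightarrow> real"
  assumes "finite S"
  shows "(\<Sum>U\<in>Pow S. g (card U)) = (\<Sum>k\<le>card S. real (card S choose k) * g k)"
proof -
  have "(\<Sum>U\<in>Pow S. g (card U)) = (\<Sum>k\<le>card S. \<Sum>U | U \<in> Pow S \<and> card U = k. g (card U))"
    using assms by (intro sum.group [symmetric]) (auto intro: card_mono)
  also have "\<dots> = (\<Sum>k\<le>card S. real (card S choose k) * g k)"
    using assms by (intro sum.cong refl) (simp add: n_subsets)
  finally show ?thesis .
qed

text \<open>Double counting of pairs \<open>(S, A)\<close>. How \<open>A\<close> cuts
  \<open>S\<close> depends only on \<open>S \<inter> A\<close>, so by \<open>frac\<close> at least a
  fifth of all \<open>A\<close> cut an \<open>S\<close> with size in \<open>\<Lambda>\<close> into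
  parts with sizes satisfying \<open>P\<close>; averaging over \<open>A\<close> therefore loses a
  factor 5.\<close>

lemma sum_le_partition_sum:
  fixes F :: "'a set \<Rightarrow> real"
  assumes V: "finite V" and F: "\<And>S. 0 \<le> F S"
    and frac: "\<And>d. d \<in> \<Lambda> \<Longrightarrow> 2 ^ d \<le> 5 * (\<Sum>k\<le>d. real (d choose k) * (if P k (d - k) then 1 else 0))"
    and le: "\<And>A. A \<subseteq> V \<Longrightarrow> (\<Sum>I\<in>Pow A. \<Sum>J\<in>Pow (V - A). if P (card I) (card J) then F (I \<union> J) else 0) \<le> X"
  shows "(\<Sum>S | S \<subseteq> V \<and> card S \<in> \<Lambda>. F S) \<le> 5 * X"
proof -
  define ind where "ind k l = (if P k l then 1 else 0 :: real)" for k l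
  have count: "2 ^ card V \<le> 5 * (\<Sum>A\<in>Pow V. ind (card (S \<inter> A)) (card (S - A)))"
    if "S \<subseteq> V" "card S \<in> \<Lambda>" for S
  proof -
    have S: "finite S" using that V finite_subset by auto
    have "(\<Sum>A\<in>Pow V. ind (card (S \<inter> A)) (card (S - A)))
        = (\<Sum>A\<in>Pow (S \<union> (V - S)). ind (card (S \<inter> A)) (card (S - A)))"
      using that by (simp add: Un_absorb1)
    also have "\<dots> = (\<Sum>U\<in>Pow S. \<Sum>U'\<in>Pow (V - S). ind (card (S \<inter> (U \<union> U'))) (card (S - (U \<union> U'))))"
      by (rule sum_Pow_Un) auto
    also have "\<dots> = (\<Sum>U\<in>Pow S. \<Sum>U'\<in>Pow (V - S). ind (card U) (card S - card U))"
    proof (intro sum.cong refl)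
      fix U U' assume U: "U \<in> Pow S" "U' \<in> Pow (V - S)"
      then have "S \<inter> (U \<union> U') = U" "S - (U \<union> U') = S - U" by auto
      moreover have "card (S - U) = card S - card U"
        using U S finite_subset by (intro card_Diff_subset) auto
      ultimately show "ind (card (S \<inter> (U \<union> U'))) (card (S - (U \<union> U'))) = ind (card U) (card S - card U)"
        by simp
    qed
    also have "\<dots> = 2 ^ card (V - S) * (\<Sum>U\<in>Pow S. ind (card U) (card S - card U))"
      using V by (simp add: card_Pow sum_distrib_left)
    also have "\<dots> = 2 ^ card (V - S) * (\<Sum>k\<le>card S. real (card S choose k) * ind k (card S - k))"
      by (simp add: sum_card_Pow [OF S, of "\<lambda>k. ind k (card S - k)"])
    finally have "5 * (\<Sum>A\<in>Pow V. ind (card (S \<inter> A)) (card (S - A))) \<ge> 2 ^ card (V - S) * 2 ^ card S"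
      using mult_left_mono [OF frac [OF that(2)], of "2 ^ card (V - S)"] by (simp add: ind_def mult_ac)
    moreover have "card (V - S) + card S = card V"
      using that V S by (simp add: card_Diff_subset card_mono)
    ultimately show ?thesis
      by (simp flip: power_add)
  qed
  have inner: "(\<Sum>S\<in>Pow V. F S * ind (card (S \<inter> A)) (card (S - A))) \<le> X" if "A \<subseteq> V" for A
  proof -
    have "(\<Sum>S\<in>Pow V. F S * ind (card (S \<inter> A)) (card (S - A)))
        = (\<Sum>S\<in>Pow (A \<union> (V - A)). F S * ind (card (S \<inter> A)) (card (S - A)))"
      using that by (simp add: Un_absorb1)
    also have "\<dots> = (\<Sum>I\<in>Pow A. \<Sum>J\<in>Pow (V - A). F (I \<union> J) * ind (card ((I \<union> J) \<inter> A)) (card ((I \<union> J) - A)))"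
      by (rule sum_Pow_Un) auto
    also have "\<dots> = (\<Sum>I\<in>Pow A. \<Sum>J\<in>Pow (V - A). if P (card I) (card J) then F (I \<union> J) else 0)"
    proof (intro sum.cong refl)
      fix I J assume "I \<in> Pow A" "J \<in> Pow (V - A)"
      then have "(I \<union> J) \<inter> A = I" "(I \<union> J) - A = J" by auto
      then show "F (I \<union> J) * ind (card ((I \<union> J) \<inter> A)) (card ((I \<union> J) - A)) = (if P (card I) (card J) then F (I \<union> J) else 0)"
        by (simp add: ind_def)
    qed
    finally show ?thesis using le [OF that] by simp
  qed
  have "2 ^ card V * (\<Sum>S | S \<subseteq> V \<and> card S \<in> \<Lambda>. F S)
      \<le> (\<Sum>S | S \<subseteq> V \<and> card S \<in> \<Lambda>. F S * (5 * (\<Sum>A\<in>Pow V. ind (card (S \<inter> A)) (card (S - A)))))"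
    unfolding sum_distrib_left [of "2 ^ card V"]
    by (intro sum_mono) (use F count in \<open>auto simp only: mult.commute [of "2 ^ card V"] mem_Collect_eq intro!: mult_left_mono\<close>)
  also have "\<dots> \<le> (\<Sum>S\<in>Pow V. F S * (5 * (\<Sum>A\<in>Pow V. ind (card (S \<inter> A)) (card (S - A)))))"
    using V F by (intro sum_mono2) (auto simp: ind_def intro!: mult_nonneg_nonneg sum_nonneg)
  also have "\<dots> = 5 * (\<Sum>A\<in>Pow V. \<Sum>S\<in>Pow V. F S * ind (card (S \<inter> A)) (card (S - A)))"
    by (subst sum.swap) (simp add: sum_distrib_left mult_ac)
  also have "\<dots> \<le> 5 * (\<Sum>A\<in>Pow V. X)"
    by (intro mult_left_mono sum_mono inner) auto
  also have "\<dots> = 2 ^ card V * (5 * X)"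
    using V by (simp add: card_Pow)
  finally show ?thesis
    by (rule mult_left_le_imp_le) simp
qed

lemma two_thirds_le_bh_exp: "2 \<le> k \<Longrightarrow> 2 / 3 \<le> bh_exp k"
  by (simp add: bh_exp_def field_simps)

text \<open>For each bipartition \<open>sum_powr_le_3\<close> interpolates between the row and the
  column estimate; averaging over bipartitions recovers the full sum.\<close>

lemma BH_partitionI:
  assumes M: "0 < M" and \<Lambda>: "\<And>k. k \<in> \<Lambda> \<Longrightarrow> 2 \<le> k"
    and frac: "\<And>d. d \<in> \<Lambda> \<Longrightarrow> 2 ^ d \<le> 5 * (\<Sum>k\<le>d. real (d choose k) * (if P k (d - k) then 1 else 0))"
    and rows: "\<And>A B c. bounded_deg m (A \<union> B) c \<Longrightarrow> A \<inter> B = {} \<Longrightarrow>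
      (\<Sum>I\<in>Pow A. (\<Sum>J\<in>Pow B. if P (card I) (card J) then (c (I \<union> J))\<^sup>2 / M else 0) powr bh_exp (card I)) \<le> 1"
    and cols: "\<And>A B c. bounded_deg m (A \<union> B) c \<Longrightarrow> A \<inter> B = {} \<Longrightarrow>
      (\<Sum>J\<in>Pow B. (\<Sum>I\<in>Pow A. if P (card I) (card J) then (c (I \<union> J))\<^sup>2 / M else 0) powr bh_exp (card J)) \<le> 1"
  shows "BH m \<Lambda> (64 * M)"
proof (rule BH_scaleI [where X = 15])
  fix k assume "k \<in> \<Lambda>"
  \<comment> \<open>The total loss is 15: a factor 5 from averaging and 3 from interpolation. Since
    \<open>bh_exp k\<close> is at least 2/3, 64 suffices, as 64^(2/3) = 16.\<close>
  have "(64::real) powr (2 / 3) = (4 powr 3) powr (2 / 3)"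
    by simp
  also have "\<dots> = 16"
    unfolding powr_powr by simp
  finally have "15 \<le> (64::real) powr (2 / 3)" by simp
  also have "\<dots> \<le> 64 powr bh_exp k"
    using two_thirds_le_bh_exp [OF \<Lambda> [OF \<open>k \<in> \<Lambda>\<close>]] by (intro powr_mono) auto
  finally show "15 \<le> (64::real) powr bh_exp k" .
next
  fix V c assume c: "bounded_deg m V c"
  have V: "finite V" using bounded_degD(1) [OF c] .
  have "(\<Sum>S | S \<subseteq> V \<and> card S \<in> \<Lambda>. ((c S)\<^sup>2 / M) powr bh_exp (card S)) \<le> 5 * 3"
  proof (rule sum_le_partition_sum [OF V _ frac])
    fix A assume "A \<subseteq> V"
    define v where "v I J = (if P (card I) (card J) then (c (I \<union> J))\<^sup>2 / M else 0)" for I J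
    have AV: "bounded_deg m (A \<union> (V - A)) c" "A \<inter> (V - A) = {}"
      using c \<open>A \<subseteq> V\<close> by (auto simp: Un_absorb1)
    have "(\<Sum>I\<in>Pow A. \<Sum>J\<in>Pow (V - A). v I J powr bh_exp (card I + card J)) \<le> 3"
      using rows [OF AV] cols [OF AV] V \<open>A \<subseteq> V\<close> M finite_subset
      by (intro sum_powr_le_3) (auto simp: v_def)
    also have "(\<Sum>I\<in>Pow A. \<Sum>J\<in>Pow (V - A). v I J powr bh_exp (card I + card J))
       = (\<Sum>I\<in>Pow A. \<Sum>J\<in>Pow (V - A). if P (card I) (card J) then ((c (I \<union> J))\<^sup>2 / M) powr bh_exp (card (I \<union> J)) else 0)"
    proof (intro sum.cong refl)
      fix I J assume IJ: "I \<in> Pow A" "J \<in> Pow (V - A)"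
      have "card (I \<union> J) = card I + card J"
        using IJ V \<open>A \<subseteq> V\<close> by (intro card_Un_disjoint) (auto intro: finite_subset [OF _ V])
      then show "v I J powr bh_exp (card I + card J)
         = (if P (card I) (card J) then ((c (I \<union> J))\<^sup>2 / M) powr bh_exp (card (I \<union> J)) else 0)"
        by (simp add: v_def)
    qed
    finally show "(\<Sum>I\<in>Pow A. \<Sum>J\<in>Pow (V - A). if P (card I) (card J)
        then ((c (I \<union> J))\<^sup>2 / M) powr bh_exp (card (I \<union> J)) else 0) \<le> 3" .
  qed auto
  then show "(\<Sum>S | S \<subseteq> V \<and> card S \<in> \<Lambda>. ((c S)\<^sup>2 / M) powr bh_exp (card S)) \<le> 15" by simp
qed (use M in auto)

text \<open>Chebyshev's inequality for the symmetric binomial distribution, whose variance is read off the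
  Bernstein polynomials at \<open>1/2\<close>, settles \<open>d \<ge> 12\<close>.\<close>

lemma balanced_binomial_ge:
  assumes "4 \<le> d"
  shows "2 ^ d \<le> 5 * (\<Sum>k\<le>d. real (d choose k) * (if d - k \<le> 2 * k \<and> k \<le> 2 * (d - k) then 1 else 0))"
proof (cases "d < 12")
  case True
  \<comment> \<open>For these \<open>d\<close> the middle binomial coefficient alone exceeds a fifth
    of 2^d.\<close>
  with assms have "d \<in> {4, 5, 6, 7, 8, 9, 10, 11}" by auto
  then have "(2::nat) ^ d \<le> 5 * (d choose (d div 2))"
    by (elim insertE emptyE) (simp_all add: binomial_fact' fact_numeral)
  then have "real (2 ^ d) \<le> real (5 * (d choose (d div 2)))"
    by (simp only: of_nat_le_iff)
  then have "2 ^ d \<le> 5 * real (d choose (d div 2))"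
    by simp
  also have "\<dots> \<le> 5 * (\<Sum>k\<in>{d div 2}. real (d choose k) * (if d - k \<le> 2 * k \<and> k \<le> 2 * (d - k) then 1 else 0))"
    using assms by (auto split: if_splits)
  also have "\<dots> \<le> 5 * (\<Sum>k\<le>d. real (d choose k) * (if d - k \<le> 2 * k \<and> k \<le> 2 * (d - k) then 1 else 0))"
    by (intro mult_left_mono sum_mono2) auto
  finally show ?thesis .
next
  case False
  define g where "g k = (if d - k \<le> 2 * k \<and> k \<le> 2 * (d - k) then 1 else 0 :: real)" for k
  have B: "Bernstein d k (1/2) = real (d choose k) / 2 ^ d" if "k \<le> d" for k
  proof -
    have "(1 / 2 :: real) ^ k * (1 - 1 / 2) ^ (d - k) = 1 / 2 ^ d"
      using that by (simp add: power_divide flip: power_add)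
    then show ?thesis
      unfolding Bernstein_def by (simp only: mult.assoc) simp
  qed
  have "(\<Sum>k\<le>d. (real k - d / 2)\<^sup>2 * Bernstein d k (1/2))
      = (\<Sum>k\<le>d. real k * (real k - 1) * Bernstein d k (1/2)) + (1 - real d) * (\<Sum>k\<le>d. real k * Bernstein d k (1/2))
        + (d / 2)\<^sup>2 * (\<Sum>k\<le>d. Bernstein d k (1/2))"
    unfolding sum_distrib_left sum.distrib [symmetric]
    by (intro sum.cong refl) (simp add: power2_eq_square algebra_simps)
  also have "\<dots> = d / 4"
    unfolding sum_kk_Bernstein sum_k_Bernstein sum_Bernstein by (simp add: power2_eq_square field_simps)
  finally have var: "(\<Sum>k\<le>d. (real k - d / 2)\<^sup>2 * Bernstein d k (1/2)) = d / 4" .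
  \<comment> \<open>An unbalanced \<open>k\<close> is at distance at least d/6 from the mean d/2.
    With variance d/4 the unbalanced mass is at most 9/d, hence at most 3/4 for \<open>d\<close> at
    least 12.\<close>
  have "(real d)\<^sup>2 / 36 * (\<Sum>k\<le>d. Bernstein d k (1/2) * (1 - g k))
      \<le> (\<Sum>k\<le>d. (real k - d / 2)\<^sup>2 * Bernstein d k (1/2))"
    unfolding sum_distrib_left
  proof (intro sum_mono)
    fix k assume k: "k \<in> {..d}"
    show "(real d)\<^sup>2 / 36 * (Bernstein d k (1/2) * (1 - g k)) \<le> (real k - d / 2)\<^sup>2 * Bernstein d k (1/2)"
    proof (cases "d - k \<le> 2 * k \<and> k \<le> 2 * (d - k)")
      case True
      then show ?thesis by (simp add: g_def Bernstein_nonneg)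
    next
      case False
      then have "real d / 6 \<le> \<bar>real k - d / 2\<bar>"
        using k by (auto simp: of_nat_diff)
      then have "(real d / 6)\<^sup>2 \<le> (real k - d / 2)\<^sup>2"
        using power_mono [of "real d / 6" "\<bar>real k - d / 2\<bar>" 2] by simp
      then have "(real d / 6)\<^sup>2 * Bernstein d k (1/2) \<le> (real k - d / 2)\<^sup>2 * Bernstein d k (1/2)"
        by (rule mult_right_mono) (simp add: Bernstein_nonneg)
      moreover have "g k = 0"
        using False by (simp add: g_def)
      ultimately show ?thesis
        by (simp add: power_divide)
    qed
  qed
  then have "d * (d * (\<Sum>k\<le>d. Bernstein d k (1/2) * (1 - g k))) \<le> d * 9"
    unfolding var by (simp add: power2_eq_square)
  then have "d * (\<Sum>k\<le>d. Bernstein d k (1/2) * (1 - g k)) \<le> 9"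
    using False by simp
  moreover have "12 * (\<Sum>k\<le>d. Bernstein d k (1/2) * (1 - g k)) \<le> d * (\<Sum>k\<le>d. Bernstein d k (1/2) * (1 - g k))"
    using False by (intro mult_right_mono sum_nonneg mult_nonneg_nonneg) (auto simp: g_def Bernstein_nonneg)
  ultimately have "(\<Sum>k\<le>d. Bernstein d k (1/2) * (1 - g k)) \<le> 3 / 4" by simp
  then have "1 / 4 \<le> (\<Sum>k\<le>d. Bernstein d k (1/2) * g k)"
    by (simp add: right_diff_distrib sum_subtractf)
  also have "(\<Sum>k\<le>d. Bernstein d k (1/2) * g k) = (\<Sum>k\<le>d. real (d choose k) * g k) / 2 ^ d"
    unfolding sum_divide_distrib by (intro sum.cong) (auto simp: B)
  finally have "1 / 4 * 2 ^ d \<le> (\<Sum>k\<le>d. real (d choose k) * g k)"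
    by (simp add: pos_le_divide_eq)
  then have "2 ^ d \<le> 4 * (\<Sum>k\<le>d. real (d choose k) * g k)"
    by simp
  also have "\<dots> \<le> 5 * (\<Sum>k\<le>d. real (d choose k) * g k)"
    by (intro mult_right_mono sum_nonneg) (auto simp: g_def)
  finally show ?thesis
    by (simp add: g_def)
qed

text \<open>The condition that neither part exceeds twice the other is what
  \<open>restricted_l2_le\<close> asks of the degree in the averaged block, and its symmetry turns
  the column estimate into a row estimate with the blocks exchanged.\<close>

lemma BH_step:
  assumes BH: "BH m \<Lambda>' M" and M: "0 < M" and \<Lambda>': "\<And>k. k \<in> \<Lambda>' \<Longrightarrow> 2 \<le> k" and \<Lambda>: "\<And>d. d \<in> \<Lambda> \<Longrightarrow> 4 \<le> d"
    and halves: "\<And>k l. l \<le> 2 * k \<Longrightarrow> k \<le> 2 * l \<Longrightarrow> k + l \<in> \<Lambda> \<Longrightarrow> k \<in> \<Lambda>'"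
  shows "BH m \<Lambda> (64 * (81 * M))"
proof -
  define P where "P k l \<longleftrightarrow> l \<le> 2 * k \<and> k \<le> 2 * l \<and> k + l \<in> \<Lambda>" for k l
  have rows: "(\<Sum>I\<in>Pow A. (\<Sum>J\<in>Pow B. if P (card I) (card J) then (c (I \<union> J))\<^sup>2 / (81 * M) else 0) powr bh_exp (card I)) \<le> 1"
    if c: "bounded_deg m (A \<union> B) c" and AB: "A \<inter> B = {}" for A B c
  proof -
    define \<T> where "\<T> I = {J \<in> Pow B. P (card I) (card J)}" for I :: "nat set"
    have fin: "finite A" "finite B" using bounded_degD(1) [OF c] by auto
    have inner: "(\<Sum>J\<in>Pow B. if P (card I) (card J) then (c (I \<union> J))\<^sup>2 / (81 * M) else 0)
        = (\<Sum>T\<in>\<T> I. (c (I \<union> T))\<^sup>2) / (81 * M)" for I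
      unfolding \<T>_def sum_divide_distrib using fin by (intro sum.inter_filter [symmetric]) auto
    have "\<T> I = {}" if "card I \<notin> \<Lambda>'" for I
      using halves that by (auto simp: \<T>_def P_def)
    then have "(\<Sum>I\<in>Pow A. (\<Sum>J\<in>Pow B. if P (card I) (card J) then (c (I \<union> J))\<^sup>2 / (81 * M) else 0) powr bh_exp (card I))
        = (\<Sum>I | I \<subseteq> A \<and> card I \<in> \<Lambda>'. ((\<Sum>T\<in>\<T> I. (c (I \<union> T))\<^sup>2) / (81 * M)) powr bh_exp (card I))"
      unfolding inner using fin by (intro sum.mono_neutral_right) auto
    also have "\<dots> \<le> 1"
      by (rule BH_rows_le [OF BH M \<Lambda>' c AB]) (auto simp: \<T>_def P_def)
    finally show ?thesis .
  qed
  have P_commute: "P k l \<longleftrightarrow> P l k" for k l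
    by (auto simp: P_def add.commute)
  show ?thesis
  proof (rule BH_partitionI [where P = P])
    fix d assume d: "d \<in> \<Lambda>"
    have "(\<Sum>k\<le>d. real (d choose k) * (if P k (d - k) then 1 else 0))
        = (\<Sum>k\<le>d. real (d choose k) * (if d - k \<le> 2 * k \<and> k \<le> 2 * (d - k) then 1 else 0))"
      using d by (intro sum.cong) (auto simp: P_def)
    then show "2 ^ d \<le> 5 * (\<Sum>k\<le>d. real (d choose k) * (if P k (d - k) then 1 else 0))"
      using balanced_binomial_ge [OF \<Lambda> [OF d]] by simp
  next
    fix A B c assume "bounded_deg m (A \<union> B) c" "A \<inter> B = {}"
    then have "bounded_deg m (B \<union> A) c" "B \<inter> A = {}" by (auto simp: Un_commute)
    moreover have "(\<Sum>J\<in>Pow B. (\<Sum>I\<in>Pow A. if P (card I) (card J) then (c (I \<union> J))\<^sup>2 / (81 * M) else 0) powr bh_exp (card J))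
        = (\<Sum>J\<in>Pow B. (\<Sum>I\<in>Pow A. if P (card J) (card I) then (c (J \<union> I))\<^sup>2 / (81 * M) else 0) powr bh_exp (card J))"
      by (intro sum.cong arg_cong2 [where f = "(powr)"] refl) (auto simp: P_commute Un_commute)
    ultimately show "(\<Sum>J\<in>Pow B. (\<Sum>I\<in>Pow A. if P (card I) (card J) then (c (I \<union> J))\<^sup>2 / (81 * M) else 0) powr bh_exp (card J)) \<le> 1"
      using rows [of B A c] by simp
  qed (use M \<Lambda> rows in \<open>auto dest: \<Lambda>\<close>)
qed

section \<open>Base levels 2 and 3, and the recursion over windows of levels\<close>

lemma BH_Un:
  assumes "BH m \<Lambda>\<^sub>1 M" "BH m \<Lambda>\<^sub>2 M" and M: "0 < M" and \<Lambda>: "\<And>k. k \<in> \<Lambda>\<^sub>1 \<union> \<Lambda>\<^sub>2 \<Longrightarrow> 2 \<le> k"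
  shows "BH m (\<Lambda>\<^sub>1 \<union> \<Lambda>\<^sub>2) (4 * M)"
proof (rule BH_scaleI [where X = 2])
  fix k assume "k \<in> \<Lambda>\<^sub>1 \<union> \<Lambda>\<^sub>2"
  have "(2::real) = 4 powr (1 / 2)"
    by (simp add: powr_half_sqrt)
  also have "\<dots> \<le> 4 powr bh_exp k"
    using two_thirds_le_bh_exp [OF \<Lambda> [OF \<open>k \<in> _\<close>]] by (intro powr_mono) auto
  finally show "(2::real) \<le> 4 powr bh_exp k" .
next
  fix V c assume c: "bounded_deg m V c"
  define F where "F S = ((c S)\<^sup>2 / M) powr bh_exp (card S)" for S
  have fin: "finite {S. S \<subseteq> V \<and> card S \<in> \<Lambda>}" for \<Lambda>
    using bounded_degD(1) [OF c] by (rule finite_subset [rotated, OF finite_Pow_iff [THEN iffD2]]) auto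
  have "{S. S \<subseteq> V \<and> card S \<in> \<Lambda>\<^sub>1 \<union> \<Lambda>\<^sub>2} = {S. S \<subseteq> V \<and> card S \<in> \<Lambda>\<^sub>1} \<union> {S. S \<subseteq> V \<and> card S \<in> \<Lambda>\<^sub>2}"
    by auto
  then have "sum F {S. S \<subseteq> V \<and> card S \<in> \<Lambda>\<^sub>1 \<union> \<Lambda>\<^sub>2}
      \<le> sum F {S. S \<subseteq> V \<and> card S \<in> \<Lambda>\<^sub>1} + sum F {S. S \<subseteq> V \<and> card S \<in> \<Lambda>\<^sub>2}"
    using fin by (simp add: sum_Un F_def sum_nonneg)
  also have "\<dots> \<le> 1 + 1"
    unfolding F_def using assms(1,2) c by (intro add_mono BH_D)
  finally show "(\<Sum>S | S \<subseteq> V \<and> card S \<in> \<Lambda>\<^sub>1 \<union> \<Lambda>\<^sub>2. ((c S)\<^sup>2 / M) powr bh_exp (card S)) \<le> 2"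
    by (simp add: F_def)
qed (use M in auto)

text \<open>The estimate \<open>level_1_rows_le\<close> in the form required by
  \<open>BH_partitionI\<close>, with \<open>bh_exp 1 = 1/2\<close>.\<close>

lemma level_1_partition_rows:
  assumes c: "bounded_deg m (A \<union> B) c" and AB: "A \<inter> B = {}" and m: "1 \<le> m" and E_pos: "0 < E"
    and E: "\<And>p. degree p \<le> m \<Longrightarrow> (\<And>s. \<bar>s\<bar> \<le> 1 \<Longrightarrow> \<bar>poly p s\<bar> \<le> 1) \<Longrightarrow> \<bar>coeff p t\<bar> \<le> E"
    and M: "(3 ^ t * (10 * real m * E))\<^sup>2 \<le> M"
  shows "(\<Sum>I\<in>Pow A. (\<Sum>J\<in>Pow B. if card I = 1 \<and> card J = t then (c (I \<union> J))\<^sup>2 / M else 0) powr bh_exp (card I)) \<le> 1"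
proof -
  define R where "R = 3 ^ t * (10 * real m * E)"
  have R: "0 < R" "R\<^sup>2 \<le> M" using m E_pos M by (auto simp: R_def)
  then have "0 < M" by (meson less_le_trans zero_less_power)
  have "sqrt (R\<^sup>2) \<le> sqrt M" using R(2) by (rule real_sqrt_le_mono)
  then have "R \<le> M powr (1/2)"
    using R \<open>0 < M\<close> by (simp add: powr_half_sqrt)
  have fin: "finite A" using bounded_degD(1) [OF c] by auto
  define U where "U i = (\<Sum>T\<in>Pow B. if card T = t then (c (insert i T))\<^sup>2 else 0)" for i
  have U: "0 \<le> U i" for i by (auto simp: U_def intro: sum_nonneg)
  have "(\<Sum>I\<in>Pow A. (\<Sum>J\<in>Pow B. if card I = 1 \<and> card J = t then (c (I \<union> J))\<^sup>2 / M else 0) powr bh_exp (card I))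
      = (\<Sum>I\<in>(\<lambda>i. {i}) ` A. (\<Sum>J\<in>Pow B. if card I = 1 \<and> card J = t then (c (I \<union> J))\<^sup>2 / M else 0) powr bh_exp (card I))"
    using fin by (intro sum.mono_neutral_right) (auto simp: card_1_singleton_iff intro!: sum.neutral)
  also have "\<dots> = (\<Sum>i\<in>A. (U i / M) powr (1/2))"
    by (subst sum.reindex) (auto simp: U_def sum_divide_distrib bh_exp_def intro!: sum.cong arg_cong2 [where f = "(powr)"])
  also have "\<dots> = (\<Sum>i\<in>A. U i powr (1/2)) / M powr (1/2)"
    using U \<open>0 < M\<close> by (simp add: powr_divide sum_divide_distrib)
  also have "\<dots> \<le> R / M powr (1/2)"
    using level_1_rows_le [OF c AB m E_pos E] \<open>0 < M\<close> by (intro divide_right_mono) (auto simp: U_def R_def)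
  also have "\<dots> \<le> 1"
    using \<open>R \<le> _\<close> \<open>0 < M\<close> by simp
  finally show ?thesis .
qed

text \<open>Level 2 is split as 1 + 1 and level 3 as 1 + 2. Blocks of size 1 are handled by
  extracting low-degree coefficients, and the block of size 2 by the inequality for level 2 just
  obtained.\<close>

lemma BH_2_3:
  assumes m: "1 \<le> m"
  shows "BH m {2, 3} (4 * (64 * (500000000 * real m ^ 6)))"
proof -
  have m1: "1 \<le> real m" and m46: "real m ^ 4 \<le> real m ^ 6"
    using m by (auto intro: power_increasing)
  define M2 where "M2 = 90000 * real m ^ 4"
  \<comment> \<open>Level 3 needs (9 * 10 * 200)^2 = 324000000 for its rows and 81 * 64 * 90000 =
    466560000 for its columns.\<close>
  define M3 where "M3 = 500000000 * real m ^ 6"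
  have M: "0 < M2" "0 < M3" using m by (auto simp: M2_def M3_def)
  have rows2: "(\<Sum>I\<in>Pow A. (\<Sum>J\<in>Pow B. if card I = 1 \<and> card J = 1 then (c (I \<union> J))\<^sup>2 / M2 else 0) powr bh_exp (card I)) \<le> 1"
    if "bounded_deg m (A \<union> B) c" "A \<inter> B = {}" for A B c
    by (rule level_1_partition_rows [OF that m _ abs_coeff_1_le])
      (use m in \<open>auto simp: M2_def power2_eq_square power4_eq_xxxx\<close>)
  have BH2: "BH m {2} (64 * M2)"
  proof (rule BH_partitionI [where P = "\<lambda>k l. k = 1 \<and> l = 1"])
    fix A B c assume "bounded_deg m (A \<union> B) c" "A \<inter> B = {}"
    then have "bounded_deg m (B \<union> A) c" "B \<inter> A = {}" by (auto simp: Un_commute)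
    moreover have "(\<Sum>J\<in>Pow B. (\<Sum>I\<in>Pow A. if card I = 1 \<and> card J = 1 then (c (I \<union> J))\<^sup>2 / M2 else 0) powr bh_exp (card J))
        = (\<Sum>J\<in>Pow B. (\<Sum>I\<in>Pow A. if card J = 1 \<and> card I = 1 then (c (J \<union> I))\<^sup>2 / M2 else 0) powr bh_exp (card J))"
      by (intro sum.cong arg_cong2 [where f = "(powr)"] refl) (auto simp: Un_commute)
    ultimately show "(\<Sum>J\<in>Pow B. (\<Sum>I\<in>Pow A. if card I = 1 \<and> card J = 1 then (c (I \<union> J))\<^sup>2 / M2 else 0) powr bh_exp (card J)) \<le> 1"
      using rows2 [of B A c] by simp
  qed (use M rows2 in \<open>auto simp: atMost_Suc numeral_2_eq_2\<close>)
  have M23: "81 * (64 * M2) \<le> M3"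
  proof -
    have "0 \<le> real m ^ 6" by simp
    with m46 show ?thesis unfolding M2_def M3_def by linarith
  qed
  have BH3: "BH m {3} (64 * M3)"
  proof (rule BH_partitionI [where P = "\<lambda>k l. k = 1 \<and> l = 2"])
    fix A B c assume c: "bounded_deg m (A \<union> B) c" "A \<inter> B = {}"
    show "(\<Sum>I\<in>Pow A. (\<Sum>J\<in>Pow B. if card I = 1 \<and> card J = 2 then (c (I \<union> J))\<^sup>2 / M3 else 0) powr bh_exp (card I)) \<le> 1"
    proof (rule level_1_partition_rows [OF c m _ abs_coeff_2_le])
      have "(3\<^sup>2 * (10 * real m * (200 * (real m)\<^sup>2)))\<^sup>2 = 324000000 * real m ^ 6"
        by (simp add: power2_eq_square numeral_eq_Suc algebra_simps)
      also have "\<dots> \<le> M3"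
        by (simp add: M3_def)
      finally show "(3\<^sup>2 * (10 * real m * (200 * (real m)\<^sup>2)))\<^sup>2 \<le> M3" .
    qed (use m in auto)
    have fin: "finite A" "finite B" using bounded_degD(1) [OF c(1)] by auto
    have BA: "bounded_deg m (B \<union> A) c" "B \<inter> A = {}" using c by (auto simp: Un_commute)
    define \<T> where "\<T> J = (if card J = 2 then {I \<in> Pow A. card I = 1} else {})" for J :: "nat set"
    have inner: "(\<Sum>I\<in>Pow A. if card I = 1 \<and> card J = 2 then (c (I \<union> J))\<^sup>2 / M3 else 0)
        = (\<Sum>I\<in>\<T> J. (c (J \<union> I))\<^sup>2) / M3" for J
    proof (cases "card J = 2")
      case True
      then show ?thesis
        unfolding \<T>_def sum_divide_distrib using fin
        by (simp only: True simp_thms if_True, subst sum.inter_filter) (auto intro!: sum.cong simp: Un_commute)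
    qed (simp add: \<T>_def)
    have "(\<Sum>J\<in>Pow B. (\<Sum>I\<in>Pow A. if card I = 1 \<and> card J = 2 then (c (I \<union> J))\<^sup>2 / M3 else 0) powr bh_exp (card J))
        = (\<Sum>J | J \<subseteq> B \<and> card J \<in> {2}. ((\<Sum>I\<in>\<T> J. (c (J \<union> I))\<^sup>2) / M3) powr bh_exp (card J))"
      unfolding inner using fin by (intro sum.mono_neutral_right) (auto simp: \<T>_def)
    also have "\<dots> \<le> (\<Sum>J | J \<subseteq> B \<and> card J \<in> {2}. ((\<Sum>I\<in>\<T> J. (c (J \<union> I))\<^sup>2) / (81 * (64 * M2))) powr bh_exp (card J))"
      using M M23 by (intro sum_mono powr_mono2 divide_left_mono divide_nonneg_nonneg sum_nonneg) (auto simp: bh_exp_def)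
    also have "\<dots> \<le> 1"
      by (rule BH_rows_le [OF BH2 _ _ BA]) (use M in \<open>auto simp: \<T>_def split: if_splits\<close>)
    finally show "(\<Sum>J\<in>Pow B. (\<Sum>I\<in>Pow A. if card I = 1 \<and> card J = 2 then (c (I \<union> J))\<^sup>2 / M3 else 0) powr bh_exp (card J)) \<le> 1" .
  qed (use M in \<open>auto simp: atMost_Suc numeral_3_eq_3\<close>)
  have "BH m ({2} \<union> {3}) (4 * (64 * M3))"
    by (rule BH_Un [OF BH_mono [OF BH2] BH3]) (use M M23 in auto)
  then show ?thesis
    by (simp add: M3_def insert_commute)
qed

text \<open>Balanced parts of levels in \<open>{a..b}\<close> lie between \<open>a / 3\<close> and
  \<open>2 * b / 3 \<le> a\<close>. This range of ratio 3 is covered by levels 2, 3 and three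
  windows of ratio 3/2, as (3/2)^3 > 3. The top shrinks by 2/3 per step, at the cost 64 * 81 * 4 * 4
  = 82944.\<close>

lemma BH_window:
  assumes BH: "BH m {2, 3} M" and M: "0 < M"
  shows "4 \<le> a \<Longrightarrow> 2 * b \<le> 3 * a \<Longrightarrow> real b \<le> 3 * (3 / 2) ^ n \<Longrightarrow> BH m {a..b} (82944 ^ n * M)"
proof (induction n arbitrary: a b)
  case 0
  \<comment> \<open>Here \<open>b \<le> 3 < a\<close>.\<close>
  then have "{a..b} = {}" by auto
  then show ?case by (simp add: BH_def)
next
  case (Suc n)
  define t where "t = 2 * b div 3"
  \<comment> \<open>Adding 2 rounds \<open>a / 3\<close> upwards. Each further window starts just
    after the uncapped end of the previous one; the caps at \<open>t\<close> below make the
    induction hypothesis applicable.\<close>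
  define a\<^sub>1 where "a\<^sub>1 = max 4 ((a + 2) div 3)"
  define a\<^sub>2 where "a\<^sub>2 = 3 * a\<^sub>1 div 2 + 1"
  define a\<^sub>3 where "a\<^sub>3 = 3 * a\<^sub>2 div 2 + 1"
  define M' where "M' = 82944 ^ n * M"
  define \<Lambda>' where "\<Lambda>' = ({2, 3} \<union> {a\<^sub>1..min (3 * a\<^sub>1 div 2) t}) \<union> ({a\<^sub>2..min (3 * a\<^sub>2 div 2) t} \<union> {a\<^sub>3..min (3 * a\<^sub>3 div 2) t})"
  have M': "0 < M'" "M \<le> M'"
    using M by (auto simp: M'_def mult_le_cancel_right1)
  have "real (3 * t) \<le> real (2 * b)"
    unfolding t_def of_nat_le_iff by simp
  then have "real t \<le> 3 * (3 / 2) ^ n"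
    using Suc.prems(3) by simp
  then have win: "BH m {e..min (3 * e div 2) t} M'" if "4 \<le> e" for e
    unfolding M'_def using that by (intro Suc.IH) (auto simp: min_def)
  have a4: "4 \<le> a\<^sub>1" "4 \<le> a\<^sub>2" "4 \<le> a\<^sub>3"
    by (auto simp: a\<^sub>1_def a\<^sub>2_def a\<^sub>3_def)
  have "BH m \<Lambda>' (4 * (4 * M'))"
    unfolding \<Lambda>'_def
  proof (intro BH_Un)
    show "BH m {2, 3} M'"
      by (rule BH_mono [OF BH _ M]) (use M' in auto)
  qed (use M' a4 win in auto)
  then have "BH m {a..b} (64 * (81 * (4 * (4 * M'))))"
  proof (rule BH_step)
    fix k l assume kl: "l \<le> 2 * k" "k \<le> 2 * l" "k + l \<in> {a..b}"
    have "t \<le> a"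
      using Suc.prems(2) by (simp add: t_def)
    moreover have "a \<le> 3 * a\<^sub>1" "3 * a\<^sub>1 + 1 \<le> 2 * a\<^sub>2" "3 * a\<^sub>2 + 1 \<le> 2 * a\<^sub>3"
      unfolding a\<^sub>2_def a\<^sub>3_def by (simp_all add: a\<^sub>1_def)
    ultimately have "t \<le> 3 * a\<^sub>3 div 2"
      by simp
    moreover have "k \<le> t" "2 \<le> k" "a \<le> 3 * k"
      using kl \<open>4 \<le> a\<close> unfolding t_def by auto
    moreover from this have "k \<in> {2, 3} \<or> a\<^sub>1 \<le> k"
      unfolding a\<^sub>1_def by auto
    ultimately show "k \<in> \<Lambda>'"
      unfolding \<Lambda>'_def a\<^sub>3_def a\<^sub>2_def by auto
  qed (use M' a4 \<open>4 \<le> a\<close> in \<open>auto simp: \<Lambda>'_def\<close>)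
  then show ?case
    by (simp add: M'_def mult.assoc)
qed

text \<open>For \<open>d > 3\<close> the number \<open>n\<close> of steps is minimal with
  \<open>d \<le> 3 * (3 / 2) ^ n\<close>, whence \<open>(3 / 2) ^ n \<le> m\<close>. As 82944 is
  below (3/2)^28, the recursion costs at most m^28 on top of the m^6 from levels 2 and 3.\<close>

lemma BH_level:
  assumes d: "2 \<le> d" "d \<le> m"
  shows "BH m {d} (200000000000 * real m ^ 34)"
proof -
  define M where "M = 4 * (64 * (500000000 * real m ^ 6))"
  have m: "1 \<le> m" using d by simp
  have M: "0 < M" using m by (simp add: M_def)
  have M_le: "M \<le> 200000000000 * real m ^ 6"
    by (simp add: M_def)
  have base: "BH m {2, 3} M"
    unfolding M_def by (rule BH_2_3 [OF m])
  show ?thesis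
  proof (cases "d \<le> 3")
    case True
    have "real m ^ 6 \<le> real m ^ 34" using m by (intro power_increasing) auto
    then have "M \<le> 200000000000 * real m ^ 34"
      using M_le by linarith
    then show ?thesis
      using True d M by (intro BH_mono [OF base]) auto
  next
    case False
    have "\<exists>n. real d \<le> 3 * (3 / 2) ^ n"
    proof -
      obtain n where "real d < (3 / 2) ^ n" using real_arch_pow [of "3/2" "real d"] by auto
      then show ?thesis by (intro exI [of _ n]) auto
    qed
    then obtain n where n: "real d \<le> 3 * (3 / 2) ^ n" and min: "\<And>i. i < n \<Longrightarrow> \<not> real d \<le> 3 * (3 / 2) ^ i"
      unfolding exists_least_iff [of "\<lambda>n. real d \<le> 3 * (3 / 2) ^ n"] by blast
    have "n \<noteq> 0" using n False by (intro notI) simp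
    then obtain i where i: "n = Suc i" using not0_implies_Suc by blast
    have "(3 / 2) ^ n \<le> real m"
      using min [of i] d by (simp add: i)
    have "82944 ^ n * M \<le> real m ^ 28 * (200000000000 * real m ^ 6)"
    proof (rule mult_mono)
      have "(82944 :: real) \<le> (3 / 2) ^ 28" by (simp add: power_divide)
      then have "(82944 :: real) ^ n \<le> ((3 / 2) ^ 28) ^ n"
        by (rule power_mono) simp
      also have "\<dots> = ((3 / 2) ^ n) ^ 28"
        by (simp add: mult.commute flip: power_mult)
      also have "\<dots> \<le> real m ^ 28"
        using \<open>(3 / 2) ^ n \<le> real m\<close> by (intro power_mono) simp_all
      finally show "82944 ^ n \<le> real m ^ 28" .
    qed (use M M_le in auto)
    also have "\<dots> = 200000000000 * real m ^ 34"
      by (simp flip: power_add)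
    finally have le: "82944 ^ n * M \<le> 200000000000 * real m ^ 34" .
    have "BH m {d..d} (82944 ^ n * M)"
      using n False by (intro BH_window [OF base M]) auto
    then show ?thesis
      by (rule BH_mono) (use M le in auto)
  qed
qed

subsection \<open>Functions on the hypercube\<close>

text \<open>Points of \<open>hypercube n\<close> are extensional while sign vectors are total, hence
  the \<open>restrict\<close>.\<close>

lemma bij_betw_sign_vec_hypercube:
  "bij_betw (\<lambda>Y. restrict (sign_vec Y) {1..n}) (Pow {1..n}) (hypercube n)"
proof (rule bij_betw_byWitness [where f' = "\<lambda>x. {j \<in> {1..n}. x j = -1}"])
  show "\<forall>Y\<in>Pow {1..n}. {j \<in> {1..n}. restrict (sign_vec Y) {1..n} j = - 1} = Y"
    by (auto simp: sign_vec_def)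
  show "\<forall>x\<in>hypercube n. restrict (sign_vec {j \<in> {1..n}. x j = - 1}) {1..n} = x"
    by (auto simp: hypercube_def sign_vec_def fun_eq_iff PiE_def Pi_def extensional_def restrict_def)
  show "(\<lambda>Y. restrict (sign_vec Y) {1..n}) ` Pow {1..n} \<subseteq> hypercube n"
    by (auto simp: hypercube_def sign_vec_def)
  show "(\<lambda>x. {j \<in> {1..n}. x j = - 1}) ` hypercube n \<subseteq> Pow {1..n}"
    by auto
qed

lemma expectation_unif_cube:
  fixes g :: "(nat \<Rightarrow> real) \<Rightarrow> real"
  shows "measure_pmf.expectation (unif_cube n) g = cube_avg {1..n} (\<lambda>y. g (restrict y {1..n}))"
proof -
  note bij = bij_betw_sign_vec_hypercube [of n]
  have "finite (hypercube n)" "hypercube n \<noteq> {}"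
    using bij_betw_finite [OF bij] bij by (auto dest: bij_betw_imp_surj_on)
  moreover have "card (hypercube n) = 2 ^ n"
    using bij_betw_same_card [OF bij] by (simp add: card_Pow)
  moreover have "(\<Sum>Y\<in>Pow {1..n}. g (restrict (sign_vec Y) {1..n})) = sum g (hypercube n)"
    by (rule sum.reindex_bij_betw [OF bij])
  ultimately show ?thesis
    by (simp add: unif_cube_def integral_pmf_of_set cube_avg_def)
qed

lemma walsh_restrict: "S \<subseteq> V \<Longrightarrow> walsh S (restrict y V) = walsh S y"
  by (rule walsh_cong) auto

text \<open>Dual orthogonality: the sum over \<open>S\<close> factors over the coordinates, and a
  coordinate where the two vertices differ contributes the factor 0.\<close>

lemma sum_walsh_mult:
  assumes "finite V" "Y \<subseteq> V" "Y' \<subseteq> V"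
  shows "(\<Sum>S\<in>Pow V. walsh S (sign_vec Y') * walsh S (sign_vec Y)) = (if Y' = Y then 2 ^ card V else 0)"
proof -
  have "(\<Sum>S\<in>Pow V. walsh S (sign_vec Y') * walsh S (sign_vec Y)) = (\<Prod>j\<in>V. sign_vec Y' j * sign_vec Y j + 1)"
    using assms by (simp add: prod_add walsh_def prod.distrib)
  also have "\<dots> = (if Y' = Y then 2 ^ card V else 0)"
  proof (cases "Y' = Y")
    case False
    then obtain j where "j \<in> Y' \<longleftrightarrow> j \<notin> Y" by auto
    then have "j \<in> V" "sign_vec Y' j * sign_vec Y j + 1 = 0"
      using assms by (auto simp: sign_vec_def)
    then show ?thesis
      using False assms by (simp add: prod_zero_iff) blast
  qed simp
  finally show ?thesis .
qed

lemma fourier_inversion: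
  assumes "Y \<subseteq> {1..n}"
  shows "walsh_poly (fourier_coeff n f) {1..n} (sign_vec Y) = f (restrict (sign_vec Y) {1..n})"
proof -
  define F where "F Y = f (restrict (sign_vec Y) {1..n})" for Y
  have "fourier_coeff n f S = (\<Sum>Y'\<in>Pow {1..n}. F Y' * walsh S (sign_vec Y')) / 2 ^ n" if "S \<subseteq> {1..n}" for S
    using that by (simp add: fourier_coeff_def expectation_unif_cube cube_avg_def walsh_restrict F_def)
  then have "walsh_poly (fourier_coeff n f) {1..n} (sign_vec Y)
      = (\<Sum>S\<in>Pow {1..n}. \<Sum>Y'\<in>Pow {1..n}. F Y' * (walsh S (sign_vec Y') * walsh S (sign_vec Y)) / 2 ^ n)"
    unfolding walsh_poly_def by (intro sum.cong) (simp_all add: sum_distrib_right sum_divide_distrib mult.assoc)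
  also have "\<dots> = (\<Sum>Y'\<in>Pow {1..n}. F Y' * (\<Sum>S\<in>Pow {1..n}. walsh S (sign_vec Y') * walsh S (sign_vec Y)) / 2 ^ n)"
    by (subst sum.swap) (simp add: sum_distrib_left sum_divide_distrib)
  also have "\<dots> = (\<Sum>Y'\<in>Pow {1..n}. if Y' = Y then F Y' else 0)"
    using assms by (intro sum.cong refl) (simp add: sum_walsh_mult)
  also have "\<dots> = F Y"
    using assms by simp
  finally show ?thesis by (simp add: F_def)
qed

text \<open>A multi-affine function on the solid cube attains its extrema at the vertices.\<close>

lemma abs_walsh_poly_box_le:
  assumes "finite V" "\<And>Y. Y \<subseteq> V \<Longrightarrow> \<bar>walsh_poly c V (sign_vec Y)\<bar> \<le> 1" "\<And>j. \<bar>x j\<bar> \<le> 1"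
  shows "\<bar>walsh_poly c V x\<bar> \<le> 1"
  using assms(1,2)
proof (induction V arbitrary: c rule: finite_induct)
  case empty
  then show ?case using empty [of "{}"] by (simp add: walsh_poly_def)
next
  case (insert j V)
  define w where "w = walsh_poly (\<lambda>T. c (insert j T)) V"
  have split: "walsh_poly c (insert j V) y = walsh_poly c V y + y j * w y" for y
    unfolding w_def using insert.hyps by (rule walsh_poly_insert)
  have comb: "walsh_poly (\<lambda>T. c T + s * c (insert j T)) V y = walsh_poly c V y + s * w y" for s y
    by (simp add: walsh_poly_def w_def sum.distrib sum_distrib_left algebra_simps)
  \<comment> \<open>Freezing coordinate \<open>j\<close> at a sign leaves a polynomial on
    \<open>V\<close> whose vertex values are vertex values of the original one.\<close>
  have "\<bar>walsh_poly (\<lambda>T. c T + s * c (insert j T)) V x\<bar> \<le> 1" if s: "s = 1 \<or> s = -1" for s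
  proof (rule insert.IH)
    fix Y assume "Y \<subseteq> V"
    define Y' where "Y' = (if s = 1 then Y else insert j Y)"
    have "sign_vec Y' j = s"
      using s \<open>Y \<subseteq> V\<close> insert.hyps by (auto simp: Y'_def sign_vec_def)
    moreover have "walsh_poly a V (sign_vec Y') = walsh_poly a V (sign_vec Y)" for a
      using insert.hyps by (intro walsh_poly_cong) (auto simp: Y'_def sign_vec_def)
    ultimately have "walsh_poly (\<lambda>T. c T + s * c (insert j T)) V (sign_vec Y) = walsh_poly c (insert j V) (sign_vec Y')"
      unfolding comb split by (simp add: w_def)
    then show "\<bar>walsh_poly (\<lambda>T. c T + s * c (insert j T)) V (sign_vec Y)\<bar> \<le> 1"
      using insert.prems [of Y'] \<open>Y \<subseteq> V\<close> by (auto simp: Y'_def split: if_splits)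
  qed
  from this [of 1] this [of "-1"]
  have "\<bar>walsh_poly c V x + w x\<bar> \<le> 1" "\<bar>walsh_poly c V x - w x\<bar> \<le> 1"
    unfolding comb by auto
  moreover have "\<bar>x j * w x\<bar> \<le> \<bar>w x\<bar>"
    using assms(3) [of j] by (simp add: abs_mult mult_left_le_one_le)
  ultimately show ?case
    unfolding split by linarith
qed

lemma bounded_deg_fourier_coeff:
  assumes f: "f \<in> hypercube n \<rightarrow> {-1..1}" and deg: "degree_at_most n m f"
  shows "bounded_deg m {1..n} (fourier_coeff n f)"
proof -
  have "\<bar>walsh_poly (fourier_coeff n f) {1..n} (sign_vec Y)\<bar> \<le> 1" if "Y \<subseteq> {1..n}" for Y
  proof -
    have "restrict (sign_vec Y) {1..n} \<in> hypercube n"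
      using bij_betw_sign_vec_hypercube [of n] that by (auto simp: bij_betw_def)
    then show ?thesis
      using f fourier_inversion [OF that, of f] by (auto simp: Pi_def abs_le_iff)
  qed
  then show ?thesis
    using deg abs_walsh_poly_box_le [of "{1..n}" "fourier_coeff n f"]
    by (auto simp: bounded_deg_def degree_at_most_def)
qed

section \<open>Variance and influences of flat functions\<close>

lemma cube_var_eq:
  "cube_var n f = (\<Sum>S\<in>Pow {1..n}. if S = {} then 0 else (fourier_coeff n f S)\<^sup>2)"
proof -
  define c where "c = fourier_coeff n f"
  define d where "d S = (if S = {} then 0 else c S)" for S
  have "measure_pmf.expectation (unif_cube n) f = c {}"
    by (simp add: c_def fourier_coeff_def)
  then have "cube_var n f = cube_avg {1..n} (\<lambda>y. (f (restrict y {1..n}) - c {})\<^sup>2)"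
    by (simp add: cube_var_def expectation_unif_cube)
  also have "\<dots> = cube_avg {1..n} (\<lambda>y. (walsh_poly d {1..n} y)\<^sup>2)"
  proof (rule cube_avg_cong)
    fix Y assume Y: "Y \<subseteq> {1..n}"
    have "walsh_poly c {1..n} y = c {} + walsh_poly d {1..n} y" for y
    proof -
      have "(\<Sum>S\<in>Pow {1..n}. (if S = {} then c {} else 0)) = c {}"
        by simp
      moreover have "walsh_poly c {1..n} y = (\<Sum>S\<in>Pow {1..n}. (if S = {} then c {} else 0) + d S * walsh S y)"
        unfolding walsh_poly_def by (intro sum.cong) (auto simp: d_def)
      ultimately show ?thesis
        by (simp add: sum.distrib walsh_poly_def)
    qed
    then have "f (restrict (sign_vec Y) {1..n}) - c {} = walsh_poly d {1..n} (sign_vec Y)"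
      using fourier_inversion [OF Y, of f] unfolding c_def by (metis add_diff_cancel_left')
    then show "(f (restrict (sign_vec Y) {1..n}) - c {})\<^sup>2 = (walsh_poly d {1..n} (sign_vec Y))\<^sup>2"
      by (rule arg_cong)
  qed
  also have "\<dots> = (\<Sum>S\<in>Pow {1..n}. (d S)\<^sup>2)"
    by (rule cube_avg_parseval) simp
  also have "\<dots> = (\<Sum>S\<in>Pow {1..n}. if S = {} then 0 else (c S)\<^sup>2)"
    by (intro sum.cong) (auto simp: d_def)
  finally show ?thesis unfolding c_def .
qed

text \<open>With N = binom(n,d) equal terms, \<open>BH\<close> reads
  \<open>N * t powr bh_exp d \<le> 1\<close>. Raised to the power 1 + 1/d, the inverse of
  \<open>bh_exp d\<close>, it becomes \<open>N * N powr (1 / d) * t \<le> 1\<close>, and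
  \<open>N powr (1 / d)\<close> is at least n/d. Level 1 follows directly from the absolute
  summability of linear coefficients.\<close>

lemma flat_level_weight_le:
  assumes c: "bounded_deg m {1..n} c" and d: "1 \<le> d" "d \<le> m" "m \<le> n"
    and flat: "\<And>S. S \<subseteq> {1..n} \<Longrightarrow> card S = d \<Longrightarrow> \<bar>c S\<bar> = \<alpha>"
  shows "real n * (real (n choose d) * \<alpha>\<^sup>2) \<le> 200000000000 * real m ^ 35"
proof (cases "d = 1")
  case True
  have "real n * \<bar>\<alpha>\<bar> = (\<Sum>i\<in>{1..n}. \<bar>\<alpha>\<bar>)"
    by simp
  also have "\<dots> = (\<Sum>i\<in>{1..n}. \<bar>c {i}\<bar>)"
    using flat True by (intro sum.cong refl) force
  also have "\<dots> \<le> 10 * real m"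
    using d by (intro level_1_sum_le [OF c]) auto
  finally have "(real n * \<bar>\<alpha>\<bar>)\<^sup>2 \<le> (10 * real m)\<^sup>2"
    by (rule power_mono) simp
  also have "\<dots> \<le> 200000000000 * real m ^ 35"
  proof -
    have "real m ^ 2 \<le> real m ^ 35" using d by (intro power_increasing) auto
    moreover have "(10 * real m)\<^sup>2 = 100 * real m ^ 2" "0 \<le> real m ^ 2"
      by (simp_all add: power_mult_distrib)
    ultimately show ?thesis by linarith
  qed
  finally show ?thesis
    using True by (simp add: power2_eq_square power_mult_distrib mult_ac)
next
  case False
  define M where "M = 200000000000 * real m ^ 34"
  define N where "N = real (n choose d)"
  define t where "t = \<alpha>\<^sup>2 / M"
  have M: "0 < M" using d by (simp add: M_def)
  have "0 < n choose d" using d by simp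
  then have N: "0 < N" by (simp add: N_def)
  have "BH m {d} M"
    unfolding M_def using d False by (intro BH_level) auto
  then have "(\<Sum>S | S \<subseteq> {1..n} \<and> card S \<in> {d}. ((c S)\<^sup>2 / M) powr bh_exp (card S)) \<le> 1"
    using c by (rule BH_D)
  also have "(\<Sum>S | S \<subseteq> {1..n} \<and> card S \<in> {d}. ((c S)\<^sup>2 / M) powr bh_exp (card S)) = (\<Sum>S | S \<subseteq> {1..n} \<and> card S \<in> {d}. t powr bh_exp d)"
  proof (intro sum.cong refl)
    fix S assume "S \<in> {S. S \<subseteq> {1..n} \<and> card S \<in> {d}}"
    then have "card S = d" "(c S)\<^sup>2 = \<alpha>\<^sup>2"
      using flat [of S] by (auto simp flip: power2_abs [of "c S"])
    then show "((c S)\<^sup>2 / M) powr bh_exp (card S) = t powr bh_exp d"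
      by (simp add: t_def)
  qed
  finally have le1: "N * t powr bh_exp d \<le> 1"
    by (simp add: N_def n_subsets)
  have root: "real n / d \<le> N powr (1 / d)"
  proof -
    have "(real n / d) ^ d \<le> N"
      unfolding N_def using d by (intro binomial_ge_n_over_k_pow_k) auto
    then have "((real n / d) ^ d) powr (1 / d) \<le> N powr (1 / d)"
      by (intro powr_mono2) auto
    moreover have "((real n / d) ^ d) powr (1 / d) = real n / d"
      using d by (simp add: powr_powr flip: powr_realpow)
    ultimately show ?thesis by simp
  qed
  have "N * (real n / d) * t \<le> 1"
  proof (cases "t = 0")
    case False
    then have t: "0 < t" using M by (simp add: t_def)
    define e where "e = 1 + 1 / real d"
    have "e = (real d + 1) / d"
      using d by (simp add: e_def add_divide_distrib)
    then have e: "bh_exp d * e = 1" "0 \<le> e"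
      using d by (simp_all add: bh_exp_def)
    have "N * (real n / d) * t \<le> N * N powr (1 / d) * t"
      using root N t by (intro mult_right_mono mult_left_mono) auto
    also have "\<dots> = (N * t powr bh_exp d) powr e"
    proof -
      have "(N * t powr bh_exp d) powr e = N powr e * t powr (bh_exp d * e)"
        using N t by (simp add: powr_mult powr_powr)
      then show ?thesis
        unfolding e(1) using N t by (simp add: e_def powr_add)
    qed
    also have "\<dots> \<le> 1 powr e"
      using N t le1 e by (intro powr_mono2) auto
    finally show ?thesis by simp
  qed simp
  then have "real n * (N * \<alpha>\<^sup>2) \<le> M * d"
    using M d by (simp add: t_def field_simps)
  also have "\<dots> \<le> M * real m"
    using M d by (intro mult_left_mono) auto
  finally show ?thesis
    using power_add [of "real m" 34 1] by (simp add: M_def N_def mult.assoc)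
qed

theorem corollary1p3:
  shows "\<exists>c::real. c > 0 \<and>
    (\<forall>(m::nat) (n::nat) (f :: (nat \<Rightarrow> real) \<Rightarrow> real).
      1 \<le> m \<longrightarrow> m \<le> n \<longrightarrow>
      f \<in> hypercube n \<rightarrow> {-1..1} \<longrightarrow>
      degree_at_most n m f \<longrightarrow>
      (\<exists>a :: nat \<Rightarrow> real. (\<forall>k\<le>m. 0 \<le> a k) \<and>
        (\<forall>S\<subseteq>{1..n}. card S \<le> m \<longrightarrow> \<bar>fourier_coeff n f S\<bar> = a (card S))) \<longrightarrow>
      (\<forall>i\<in>{1..n}. influence n i f \<ge> c / real m ^ 54 * (cube_var n f)\<^sup>2))"
proof (intro exI [of _ "1 / 200000000000"] conjI allI impI ballI)
  fix m n :: nat and f :: "(nat \<Rightarrow> real) \<Rightarrow> real" and i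
  assume m: "1 \<le> m" and "m \<le> n" and f: "f \<in> hypercube n \<rightarrow> {-1..1}" and deg: "degree_at_most n m f"
    and "\<exists>a :: nat \<Rightarrow> real. (\<forall>k\<le>m. 0 \<le> a k) \<and>
        (\<forall>S\<subseteq>{1..n}. card S \<le> m \<longrightarrow> \<bar>fourier_coeff n f S\<bar> = a (card S))"
    and i: "i \<in> {1..n}"
  then obtain a :: "nat \<Rightarrow> real" where
    a: "\<And>S. S \<subseteq> {1..n} \<Longrightarrow> card S \<le> m \<Longrightarrow> \<bar>fourier_coeff n f S\<bar> = a (card S)" by blast
  \<comment> \<open>The common squared coefficient of a level; its value 0 at level 0 and above
    \<open>m\<close> turns variance and influence into plain binomial sums.\<close>
  define g where "g k = (if k = 0 \<or> m < k then 0 else (a k)\<^sup>2)" for k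
  define K where "K = 200000000000 * real m ^ 36"
  define Var where "Var = cube_var n f"
  have c: "bounded_deg m {1..n} (fourier_coeff n f)"
    using f deg by (rule bounded_deg_fourier_coeff)
  have sq: "(fourier_coeff n f S)\<^sup>2 = g (card S)" if "S \<subseteq> {1..n}" "S \<noteq> {}" for S
  proof (cases "card S \<le> m")
    case True
    have "finite S" using that finite_subset by auto
    then show ?thesis
      using True that a [of S] by (auto simp: g_def simp flip: power2_abs [of "fourier_coeff n f S"])
  next
    case False
    then show ?thesis
      using bounded_degD(2) [OF c that(1)] by (simp add: g_def)
  qed
  have "Var = (\<Sum>S\<in>Pow {1..n}. g (card S))"
    unfolding Var_def cube_var_eq by (intro sum.cong) (auto simp: sq, simp add: g_def)
  also have "\<dots> = (\<Sum>k\<le>n. real (n choose k) * g k)"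
    by (simp add: sum_card_Pow)
  finally have Var_eq: "Var = (\<Sum>k\<le>n. real (n choose k) * g k)" .
  then have "0 \<le> Var"
    by (auto simp: g_def intro!: sum_nonneg)
  have "real n * Var = (\<Sum>k\<in>{1..m}. real n * (real (n choose k) * g k))"
    unfolding Var_eq sum_distrib_left using \<open>m \<le> n\<close>
    by (intro sum.mono_neutral_right) (auto simp: g_def)
  also have "\<dots> \<le> (\<Sum>k\<in>{1..m}. 200000000000 * real m ^ 35)"
  proof (rule sum_mono)
    fix k assume k: "k \<in> {1..m}"
    have "real n * (real (n choose k) * (a k)\<^sup>2) \<le> 200000000000 * real m ^ 35"
      using k \<open>m \<le> n\<close> a by (intro flat_level_weight_le [OF c]) auto
    then show "real n * (real (n choose k) * g k) \<le> 200000000000 * real m ^ 35"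
      using k by (simp add: g_def)
  qed
  also have "\<dots> = K"
    using power_add [of "real m" 1 35] by (simp add: K_def)
  finally have n_Var: "real n * Var \<le> K" .
  define W where "W = {1..n} - {i}"
  have W: "{1..n} = insert i W" "finite W" "i \<notin> W" "card W = n - 1"
    using i by (auto simp: W_def)
  have "influence n i f = (\<Sum>S\<in>Pow (insert i W). if i \<in> S then g (card S) else 0)"
    unfolding influence_def W(1) [symmetric] sum.inter_filter [OF finite_Pow_iff [THEN iffD2, OF finite_atLeastAtMost], symmetric]
    by (intro sum.cong) (auto intro!: sq)
  also have "\<dots> = (\<Sum>T\<in>Pow W. g (Suc (card T)))"
  proof -
    have "(\<Sum>S\<in>Pow W. if i \<in> S then g (card S) else 0) = 0"
      using W by (intro sum.neutral) auto
    moreover have "card (insert i T) = Suc (card T)" if "T \<in> Pow W" for T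
      using that W finite_subset by (subst card_insert_disjoint) auto
    ultimately show ?thesis
      using W by (simp add: sum_Pow_insert)
  qed
  also have "\<dots> = (\<Sum>k\<le>n - 1. real (n - 1 choose k) * g (Suc k))"
    using sum_card_Pow [OF W(2), of "\<lambda>k. g (Suc k)"] W(4) by simp
  finally have Inf_eq: "influence n i f = (\<Sum>k\<le>n - 1. real (n - 1 choose k) * g (Suc k))" .
  obtain n' where n': "n = Suc n'" using i by (cases n) auto
  have "Var = (\<Sum>k\<le>n'. real (n choose Suc k) * g (Suc k))"
    unfolding Var_eq n' sum.atMost_Suc_shift by (simp add: g_def)
  \<comment> \<open>The Poincare inequality: flatness makes all influences equal, so their sum is
    \<open>n\<close> times one of them. In coefficients this is binom(n,k+1) \<le> (k+1)
    binom(n,k+1) = n binom(n-1,k).\<close>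
  also have "\<dots> \<le> (\<Sum>k\<le>n'. real n * (real (n - 1 choose k) * g (Suc k)))"
  proof (rule sum_mono)
    fix k
    have "n choose Suc k \<le> Suc k * (n choose Suc k)" by simp
    also have "\<dots> = n * (n - 1 choose k)"
      unfolding n' by (metis Suc_times_binomial diff_Suc_1)
    finally have "real (n choose Suc k) \<le> real n * real (n - 1 choose k)"
      by (metis of_nat_le_iff of_nat_mult)
    then have "real (n choose Suc k) * g (Suc k) \<le> (real n * real (n - 1 choose k)) * g (Suc k)"
      by (rule mult_right_mono) (simp add: g_def)
    then show "real (n choose Suc k) * g (Suc k) \<le> real n * (real (n - 1 choose k) * g (Suc k))"
      by (simp add: mult.assoc)
  qed
  also have "\<dots> = real n * influence n i f"
    unfolding Inf_eq by (simp add: n' sum_distrib_left)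
  finally have Var_le: "Var \<le> real n * influence n i f" .
  have "0 < K" "0 < real n" using m \<open>m \<le> n\<close> by (auto simp: K_def)
  \<comment> \<open>The small variance \<open>n * Var \<le> K\<close> and the Poincare bound combine
    so that the factor \<open>n\<close> cancels.\<close>
  have "real n * Var\<^sup>2 \<le> K * Var"
    using mult_right_mono [OF n_Var \<open>0 \<le> Var\<close>] by (simp add: power2_eq_square mult.assoc)
  also have "\<dots> \<le> K * (real n * influence n i f)"
    using Var_le \<open>0 < K\<close> by (intro mult_left_mono) auto
  finally have "real n * Var\<^sup>2 \<le> real n * (K * influence n i f)"
    by (simp add: mult_ac)
  then have "Var\<^sup>2 / K \<le> influence n i f"
    using \<open>0 < K\<close> \<open>0 < real n\<close> by (simp add: divide_le_eq mult.commute)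
  \<comment> \<open>The exponent reached is 36 = 34 + 1 + 1, from \<open>BH_level\<close>, the
    factor \<open>d\<close> in n/d and the sum over \<open>m\<close> levels; it is weakened to 54
    using \<open>1 \<le> m\<close>.\<close>
  moreover have "Var\<^sup>2 / (200000000000 * real m ^ 54) \<le> Var\<^sup>2 / K"
    using m unfolding K_def by (intro divide_left_mono mult_left_mono power_increasing) auto
  ultimately show "1 / 200000000000 / real m ^ 54 * (cube_var n f)\<^sup>2 \<le> influence n i f"
    by (simp add: Var_def)
qed simp

end
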